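(* For every integer $n\ge 1$ there is a uniformly closed subalgebra $A_n$ of the disk algebra $A(\overline{\mathbb D})$ that is algebraically isomorphic (isomorphic as a complex algebra) to the polydisk algebra $A(\overline{\mathbb D}^{\,n})$. Moreover, there is a uniformly closed subalgebra $A_\infty$ of $A(\overline{\mathbb D})$ that is algebraically isomorphic to the infinite polydisk algebra $A(\mathbf D^\infty)$.
   Context: $\mathbb D=\{z\in\mathbb C:|z|<1\}$ is the open unit disk and $\overline{\mathbb D}=\{z\in\mathbb C:|z|\le 1\}$ its closure. The disk algebra $A(\overline{\mathbb D})$ is the algebra of all functions $\overline{\mathbb D}\to\mathbb C$ that are continuous on $\overline{\mathbb D}$ and holomorphic on $\mathbb D$. For an integer $n\geq 1$, the polydisk algebra $A(\overline{\mathbb D}^{\,n})$ is the algebra of all complex-valued functions continuous on the closed polydisk $\overline{\mathbb D}^{\,n}$ and holomorphic on $\mathbb D^n$. The infinite polydisk is $\mathbf D^\infty=\prod_{k\in\mathbb N}\overline{\mathbb D}$ (countably infinite product) with the product topology. The infinite polydisk algebra $A(\mathbf D^\infty)$ is the smallest uniformly closed unital subalgebra of $C(\mathbf D^\infty,\mathbb C)$ (the continuous complex-valued functions on $\mathbf D^\infty$) containing all the coordinate functions $z_1,z_2,\dots$; equivalently, the uniform closure of the polynomials in finitely many of the coordinates. All algebras carry pointwise operations; "uniformly closed" means closed with respect to the supremum norm. *)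

theory Defs
  imports "HOL-Complex_Analysis.Complex_Analysis"
begin

text \<open>
  A function \<open>K \<rightarrow> \<complex>\<close> is represented by a total function that is
  \<^const>\<open>extensional\<close> on \<open>K\<close>, so that equality of representatives is equality on \<open>K\<close>.
  The pointwise operations are restricted to \<open>K\<close> accordingly.
\<close>

definition continuous_functions :: "'a::topological_space set \<Rightarrow> ('a \<Rightarrow> complex) set" where
  "continuous_functions K = {f \<in> extensional K. continuous_on K f}"

definition unital_subalgebra :: "'a set \<Rightarrow> ('a \<Rightarrow> complex) set \<Rightarrow> ('a \<Rightarrow> complex) set \<Rightarrow> bool" where
  "unital_subalgebra K B A \<longleftrightarrow>
     A \<subseteq> B \<and>
     (\<lambda>x\<in>K. 1) \<in> A \<and>
     (\<forall>f\<in>A. \<forall>g\<in>A. (\<lambda>x\<in>K. f x + g x) \<in> A) \<and>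
     (\<forall>f\<in>A. \<forall>g\<in>A. (\<lambda>x\<in>K. f x * g x) \<in> A) \<and>
     (\<forall>c. \<forall>f\<in>A. (\<lambda>x\<in>K. c * f x) \<in> A)"

text \<open>
  The limit is not required to lie in an ambient algebra: uniform limits of continuous
  (holomorphic) functions are again continuous (holomorphic).
\<close>

definition uniformly_closed :: "'a set \<Rightarrow> ('a \<Rightarrow> complex) set \<Rightarrow> bool" where
  "uniformly_closed K A \<longleftrightarrow>
     (\<forall>F f. (\<forall>m. F m \<in> A) \<and> f \<in> extensional K \<and> uniform_limit K F f sequentially \<longrightarrow> f \<in> A)"

definition algebra_isomorphic ::
    "'a set \<Rightarrow> ('a \<Rightarrow> complex) set \<Rightarrow> 'b set \<Rightarrow> ('b \<Rightarrow> complex) set \<Rightarrow> bool" where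
  "algebra_isomorphic K A L B \<longleftrightarrow>
     (\<exists>\<Phi>. bij_betw \<Phi> A B \<and>
          \<Phi> (\<lambda>x\<in>K. 1) = (\<lambda>y\<in>L. 1) \<and>
          (\<forall>f\<in>A. \<forall>g\<in>A. \<Phi> (\<lambda>x\<in>K. f x + g x) = (\<lambda>y\<in>L. \<Phi> f y + \<Phi> g y)) \<and>
          (\<forall>f\<in>A. \<forall>g\<in>A. \<Phi> (\<lambda>x\<in>K. f x * g x) = (\<lambda>y\<in>L. \<Phi> f y * \<Phi> g y)) \<and>
          (\<forall>c. \<forall>f\<in>A. \<Phi> (\<lambda>x\<in>K. c * f x) = (\<lambda>y\<in>L. c * \<Phi> f y)))"

definition disk_algebra :: "(complex \<Rightarrow> complex) set" where
  "disk_algebra = {f \<in> continuous_functions (cball 0 1). f holomorphic_on ball 0 1}"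

text \<open>
  The dimension \<open>n \<ge> 1\<close> is the cardinality of the index type \<open>'n\<close>.
\<close>

definition open_polydisk :: "(complex ^ 'n::finite) set" where
  "open_polydisk = {z. \<forall>i. z $ i \<in> ball 0 1}"

definition closed_polydisk :: "(complex ^ 'n::finite) set" where
  "closed_polydisk = {z. \<forall>i. z $ i \<in> cball 0 1}"

text \<open>
  Holomorphy in several variables on an open set: the Frechet derivative exists at every
  point and is complex-linear (\<^const>\<open>has_derivative\<close> by itself only gives real linearity).
\<close>

definition holomorphic_several_on ::
    "(complex ^ 'n::finite \<Rightarrow> complex) \<Rightarrow> (complex ^ 'n) set \<Rightarrow> bool" where
  "holomorphic_several_on f U \<longleftrightarrow>
     (\<forall>z\<in>U. \<exists>f'. (f has_derivative f') (at z) \<and> (\<forall>c v. f' (c *s v) = c * f' v))"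

definition polydisk_algebra :: "(complex ^ 'n::finite \<Rightarrow> complex) set" where
  "polydisk_algebra =
     {f \<in> continuous_functions closed_polydisk. holomorphic_several_on f open_polydisk}"

text \<open>
  The topology on \<^typ>\<open>nat \<Rightarrow> complex\<close> is the product topology.
\<close>

definition infinite_polydisk :: "(nat \<Rightarrow> complex) set" where
  "infinite_polydisk = {z. \<forall>k. z k \<in> cball 0 1}"

definition infinite_polydisk_algebra :: "((nat \<Rightarrow> complex) \<Rightarrow> complex) set" where
  "infinite_polydisk_algebra =
     \<Inter>{A. unital_subalgebra infinite_polydisk (continuous_functions infinite_polydisk) A \<and>
         uniformly_closed infinite_polydisk A \<and>
         (\<forall>k. (\<lambda>z\<in>infinite_polydisk. z k) \<in> A)}"

end

theory Submission
  imports Defs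
begin

text \<open>
  Since a function of either polydisk algebra attains its norm on the torus, composing with
  \<open>\<Phi> = (F\<^sub>k)\<close> embeds the algebra isometrically in the disk algebra as soon as the \<open>F\<^sub>k\<close> in the
  disk algebra are bounded by 1 and every point of the infinite torus is of the form \<open>\<Phi> \<zeta>\<close>;
  a Cauchy sequence of the image then comes from a Cauchy sequence upstairs, so the image is closed.

  Such a \<open>\<Phi>\<close> comes from a Cantor set on the unit circle, whose points carry binary sequences
  \<open>b\<close>. The points with \<open>b\<^sub>j\<close> false and those with \<open>b\<^sub>j\<close> true are zero sets of two functions in the
  disk algebra with values in a thin sector (Fatou). From their quotient one gets \<open>h\<^sub>j\<close> in the
  disk algebra with values in the closed upper half plane, bounded by 1 and equal to \<open>b\<^sub>j\<close> on the
  Cantor set. Because \<open>Im h\<^sub>j \<ge> 0\<close>, the function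
  \<open>F\<^sub>k = exp (2\<pi>i \<Sum>\<^sub>j 2^-(j+1) h\<^bsub>(k,j)\<^esub>)\<close> is bounded by 1, and on the Cantor set its argument
  is an arbitrary binary expansion.
\<close>

section \<open>Functions in the disk algebra with prescribed zero set\<close>

text \<open>Since \<open>a\<close> is unimodular, \<open>cnj a * z\<close> lies in the closed unit
  disk and \<open>norm (1 - cnj a * z)\<close> equals \<open>dist z a\<close>. So
  \<open>1 - cnj a * z\<close> has nonnegative real part, and adding \<open>e\<close> moves it to
  the right, which can only increase its modulus.\<close>

lemma peak_kernel_denominator:
  fixes a z :: complex and e :: real
  assumes a: "norm a = 1" and z: "norm z \<le> 1" and e: "0 < e"
  shows "Re (1 + e - cnj a * z) > 0" and "dist z a \<le> norm (1 + e - cnj a * z)"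
proof -
  have "Re (cnj a * z) \<le> norm (cnj a * z)" by (rule complex_Re_le_cmod)
  also have "\<dots> \<le> 1" using a z by (simp add: norm_mult)
  finally have re: "Re (cnj a * z) \<le> 1" .
  then show "Re (1 + e - cnj a * z) > 0" using e by simp
  have "a * cnj a = 1" using a by (simp flip: complex_norm_square)
  then have "a * (1 - cnj a * z) = a - z" by (simp add: right_diff_distrib flip: mult.assoc)
  then have "dist z a = norm (a * (1 - cnj a * z))" by (simp add: dist_norm norm_minus_commute)
  also have "\<dots> = norm (1 - cnj a * z)" using a by (simp add: norm_mult)
  also have "\<dots> \<le> norm (1 + e - cnj a * z)"
    unfolding cmod_def using re e by (intro real_sqrt_le_mono) (auto intro!: power_mono)
  finally show "dist z a \<le> norm (1 + e - cnj a * z)" .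
qed

lemma Re_divide_of_real_numerator:
  "Re (of_real e / w) = e * Re w / (norm w)\<^sup>2"
  by (simp add: Re_divide cmod_power2)

lemma peak_kernel_Re_nonneg:
  assumes "norm a = 1" "norm z \<le> 1" "0 < e"
  shows "0 \<le> Re (of_real e / (1 + of_real e - cnj a * z))"
proof -
  have "0 < Re (1 + of_real e - cnj a * z)" using peak_kernel_denominator(1)[OF assms] by simp
  then show ?thesis using assms(3) unfolding Re_divide_of_real_numerator by simp
qed

text \<open>With \<open>w = 1 - cnj a * z\<close> the kernel is \<open>e / (e + w)\<close>, where
  \<open>norm w <= e\<close> and \<open>0 <= Re w\<close>. Hence the numerator of its real part is
  at least \<open>e * e\<close>, and the denominator is at most the square of
  \<open>2 * e\<close>.\<close>

lemma peak_kernel_Re_ge: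
  assumes a: "norm a = 1" and z: "norm z \<le> 1" and e: "0 < e" and d: "dist z a \<le> e"
  shows "1/4 \<le> Re (of_real e / (1 + of_real e - cnj a * z))"
proof -
  define w where "w = 1 - cnj a * z"
  have "Re (cnj a * z) \<le> norm (cnj a * z)" by (rule complex_Re_le_cmod)
  also have "\<dots> \<le> 1" using a z by (simp add: norm_mult)
  finally have re: "0 \<le> Re w" by (simp add: w_def)
  have "a * cnj a = 1" using a by (simp flip: complex_norm_square)
  then have "a * w = a - z" by (simp add: w_def right_diff_distrib flip: mult.assoc)
  then have "norm w = norm (a - z)" using a by (metis norm_mult mult_1)
  with d have w: "norm w \<le> e" by (simp add: dist_norm norm_minus_commute)
  have "norm (e + w) \<le> 2 * e" using norm_triangle_ineq[of "of_real e" w] w e by simp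
  then have sq: "(norm (e + w))\<^sup>2 \<le> 4 * e\<^sup>2" 
    using power_mono[of "norm (e + w)" "2 * e" 2] by (simp add: power_mult_distrib)
  have "Re (of_real e / (of_real e + w)) = e * (e + Re w) / (norm (e + w))\<^sup>2"
    by (simp add: Re_divide_of_real_numerator)
  moreover have "(norm (e + w))\<^sup>2 > 0" using re e by (auto simp: complex_eq_iff)
  moreover have "e * e \<le> e * (e + Re w)" using re e by simp
  ultimately have "1/4 \<le> Re (of_real e / (of_real e + w))"
    using sq by (simp only: le_divide_eq power2_eq_square) auto
  then show ?thesis by (simp add: w_def algebra_simps)
qed

text \<open>
  Fatou's construction: the kernels peak near the points of the nets, so their sum has an
  infinite real part exactly on \<open>K\<close>, and the function sought is the reciprocal of that sum.
\<close>

lemma disk_function_with_zero_set: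
  fixes K :: "complex set" and A :: "nat \<Rightarrow> complex set" and e :: "nat \<Rightarrow> real"
  assumes K: "K \<subseteq> sphere 0 1" "closed K"
    and A: "\<And>j. finite (A j)" "\<And>j. A j \<subseteq> K" and e: "\<And>j. 0 < e j"
    and sm: "summable (\<lambda>j. real (card (A j)) * e j)"
    and net: "\<And>j p. p \<in> K \<Longrightarrow> \<exists>a\<in>A j. dist p a \<le> e j"
  obtains P where "continuous_on (cball 0 1) P" "P holomorphic_on ball 0 1"
    "\<And>z. z \<in> K \<Longrightarrow> P z = 0" "\<And>z. z \<in> cball 0 1 - K \<Longrightarrow> Re (P z) > 0"
proof -
  define s where "s j z = (\<Sum>a\<in>A j. of_real (e j) / (1 + of_real (e j) - cnj a * z))" for j z
  define H where "H z = 1 + (\<Sum>j. s j z)" for z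
  \<comment> \<open>The value 0 on \<open>K\<close> is the limit of \<open>1 / H\<close> there,
    because the real part of \<open>H\<close> grows without bound near \<open>K\<close>.\<close>
  define P where "P z = (if z \<in> K then 0 else 1 / H z)" for z
  have nA: "norm a = 1" if "a \<in> A j" for a j
    using that A(2) K(1) by (auto simp: subset_iff)
  have den: "1 + of_real (e j) - cnj a * z \<noteq> 0" if "a \<in> A j" "z \<in> cball 0 1" for a j z
    using peak_kernel_denominator(1)[OF nA[OF that(1)] _ e[of j], of z] that(2) by force
  have s_Re: "0 \<le> Re (s j z)" if "z \<in> cball 0 1" for j z
    unfolding s_def Re_sum
    using that nA e by (intro sum_nonneg peak_kernel_Re_nonneg) auto
  have s_cont: "continuous_on (cball 0 1) (s j)" for j
    unfolding s_def by (intro continuous_intros) (use den in auto)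
  have s_hol: "s j holomorphic_on ball 0 1" for j
    unfolding s_def by (intro holomorphic_intros) (use den in auto)
  \<comment> \<open>At distance at least \<open>d\<close> from \<open>K\<close> every kernel of
    level \<open>j\<close> is at most \<open>e j / d\<close> in norm, so on \<open>V d\<close> the
    series is dominated by a multiple of the one in \<open>sm\<close>. Each point off
    \<open>K\<close> has a relative neighbourhood inside some \<open>V d\<close>.\<close>
  define V where "V d = {z \<in> cball 0 1. \<forall>a\<in>K. d \<le> dist z a}" for d
  have s_norm: "norm (s j z) \<le> (real (card (A j)) * e j) * (1/d)" if "z \<in> V d" "0 < d" for j z d
  proof -
    have "norm (s j z) \<le> (\<Sum>a\<in>A j. e j / d)"
      unfolding s_def
    proof (rule sum_norm_le)
      fix a assume a: "a \<in> A j"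
      have "d \<le> dist z a" using a that A(2) by (auto simp: V_def)
      also have "\<dots> \<le> norm (1 + e j - cnj a * z)"
        using that nA[OF a] e by (intro peak_kernel_denominator) (auto simp: V_def)
      finally show "norm (of_real (e j) / (1 + of_real (e j) - cnj a * z)) \<le> e j / d"
        using e[of j] that(2) by (simp add: norm_divide frac_le)
    qed
    then show ?thesis by simp
  qed
  have ul: "uniform_limit (V d) (\<lambda>n z. \<Sum>j<n. s j z) (\<lambda>z. \<Sum>j. s j z) sequentially" if "0 < d" for d
    by (rule Weierstrass_m_test[OF s_norm[OF _ that] summable_mult2[OF sm]])
  have summ: "summable (\<lambda>j. s j z)" if "z \<in> V d" "0 < d" for z d
    using s_norm[OF that] by (rule summable_comparison_test'[OF summable_mult2[OF sm]])
  have inV: "\<exists>d>0. ball z d \<inter> cball 0 1 \<subseteq> V d" if "z \<notin> K" for z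
  proof -
    have "z \<in> - K" using that by simp
    with open_Compl[OF K(2)] obtain d where d: "d > 0" "ball z d \<subseteq> - K" by (rule openE)
    have "ball z (d/2) \<inter> cball 0 1 \<subseteq> V (d/2)"
    proof
      fix w assume w: "w \<in> ball z (d/2) \<inter> cball 0 1"
      have "d/2 \<le> dist w a" if "a \<in> K" for a
      proof -
        have "dist z a \<ge> d" using d that by force
        then show ?thesis using w dist_triangle[of z a w] by simp
      qed
      then show "w \<in> V (d/2)" using w by (auto simp: V_def)
    qed
    then show ?thesis using d by (intro exI[of _ "d/2"]) auto
  qed
  have summ': "summable (\<lambda>j. s j z)" if "z \<in> cball 0 1 - K" for z
  proof -
    have "z \<notin> K" using that by simp
    then obtain d where d: "d > 0" "ball z d \<inter> cball 0 1 \<subseteq> V d" using inV by metis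
    have "z \<in> V d" by (rule subsetD[OF d(2)]) (use that d(1) in auto)
    then show ?thesis using d(1) by (rule summ)
  qed
  \<comment> \<open>All terms have nonnegative real part, so partial sums bound
    \<open>Re (H z)\<close> from below. The case \<open>n = 0\<close> keeps \<open>H\<close> away
    from zero; large \<open>n\<close> gives the blow-up near \<open>K\<close>.\<close>
  have H_ge: "1 + (\<Sum>j<n. Re (s j z)) \<le> Re (H z)" if z: "z \<in> cball 0 1 - K" for z n
  proof -
    have "Re (H z) = 1 + (\<Sum>j. Re (s j z))" using sums_unique[OF sums_Re[OF summable_sums[OF summ'[OF z]]]] by (simp add: H_def)
    moreover have "(\<Sum>j<n. Re (s j z)) \<le> (\<Sum>j. Re (s j z))"
      using summable_Re[OF summ'[OF z]] s_Re z by (intro sum_le_suminf) auto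
    ultimately show ?thesis by simp
  qed
  have H1: "1 \<le> Re (H z)" if "z \<in> cball 0 1 - K" for z using H_ge[OF that, of 0] by simp
  have ballK: "ball 0 1 \<inter> K = {}" using K(1) by auto
  show ?thesis
  proof
    show "P z = 0" if "z \<in> K" for z using that by (simp add: P_def)
    show "Re (P z) > 0" if "z \<in> cball 0 1 - K" for z
    proof -
      have "P z = inverse (H z)" using that by (simp add: P_def inverse_eq_divide)
      moreover have "(Re (H z))\<^sup>2 + (Im (H z))\<^sup>2 > 0"
        using H1[OF that] by (intro add_pos_nonneg) auto
      ultimately show ?thesis using H1[OF that] by simp
    qed
    have "(\<lambda>z. \<Sum>j. s j z) holomorphic_on ball 0 1"
    proof (rule holomorphic_uniform_sequence)
      show "(\<lambda>z. \<Sum>j<n. s j z) holomorphic_on ball 0 1" for n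
        by (intro holomorphic_on_sum s_hol)
      fix z :: complex assume z: "z \<in> ball 0 1"
      then obtain d where d: "d > 0" "ball z d \<inter> cball 0 1 \<subseteq> V d" using inV[of z] ballK by (metis disjoint_iff)
      obtain c where c: "c > 0" "cball z c \<subseteq> ball 0 1" using z open_contains_cball by blast
      have "cball z (min c (d/2)) \<subseteq> ball z d \<inter> cball 0 1" 
        using c d ball_subset_cball by fastforce
      moreover have "cball z (min c (d/2)) \<subseteq> ball 0 1" using c by auto
      ultimately show "\<exists>r>0. cball z r \<subseteq> ball 0 1 \<and>
          uniform_limit (cball z r) (\<lambda>n z. \<Sum>j<n. s j z) (\<lambda>z. \<Sum>j. s j z) sequentially"
        using c d by (intro exI[of _ "min c (d/2)"] conjI uniform_limit_on_subset[OF ul[OF d(1)]]) auto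
    qed simp
    moreover have "H z \<noteq> 0" if "z \<in> ball 0 1" for z
      using H1[of z] ballK that by (cases "z \<in> K") auto
    ultimately have "(\<lambda>z. 1 / H z) holomorphic_on ball 0 1"
      unfolding H_def by (intro holomorphic_intros)
    then show "P holomorphic_on ball 0 1"
      by (rule holomorphic_transform) (use ballK in \<open>auto simp: P_def\<close>)
    show "continuous_on (cball 0 1) P"
      unfolding continuous_on_eq_continuous_within
    proof
      fix p :: complex assume p: "p \<in> cball 0 1"
      show "continuous (at p within cball 0 1) P"
      proof (cases "p \<in> K")
        case False
        then obtain d where d: "d > 0" "ball p d \<inter> cball 0 1 \<subseteq> V d" using inV by metis
        have "continuous_on (V d) (\<lambda>z. \<Sum>j. s j z)"
          by (rule uniform_limit_theorem[OF _ ul[OF d(1)]])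
            (auto intro!: always_eventually continuous_on_sum continuous_on_subset[OF s_cont] simp: V_def)
        then have "continuous_on (ball p d \<inter> cball 0 1) (\<lambda>z. \<Sum>j. s j z)"
          using d(2) by (rule continuous_on_subset)
        moreover have notK: "z \<notin> K" if "z \<in> ball p d \<inter> cball 0 1" for z
          using subsetD[OF d(2) that] d(1) by (force simp: V_def)
        moreover have "H z \<noteq> 0" if "z \<in> ball p d \<inter> cball 0 1" for z
          using H1[of z] notK[OF that] that by auto
        ultimately have "continuous_on (ball p d \<inter> cball 0 1) (\<lambda>z. 1 / H z)"
          unfolding H_def by (intro continuous_intros) auto
        moreover have "P z = 1 / H z" if "z \<in> ball p d \<inter> cball 0 1" for z
          using notK[OF that] by (simp add: P_def)
        ultimately have "continuous_on (ball p d \<inter> cball 0 1) P" by (metis (no_types, lifting) continuous_on_cong)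
        then have "continuous (at p within (ball p d \<inter> cball 0 1)) P"
          using p d(1) by (simp add: continuous_on_eq_continuous_within)
        moreover have "at p within (ball p d \<inter> cball 0 1) = at p within cball 0 1"
          using d(1) by (intro at_within_nhd[of p "ball p d"]) auto
        ultimately show ?thesis by simp
      next
        case True
        show ?thesis
          unfolding continuous_within_eps_delta
        proof (intro allI impI)
          fix r :: real assume r: "0 < r"
          \<comment> \<open>The first \<open>n\<close> levels contribute at least
            \<open>n / 4\<close> to the real part at \<open>p\<close>. Continuity of this finite sum
            loses at most \<open>n / 8\<close> nearby, and the remaining \<open>n / 8\<close>
            exceeds \<open>1 / r\<close>, so \<open>1 / H\<close> is below \<open>r\<close> in
            norm.\<close>
          obtain n :: nat where n: "8 / r < real n" using reals_Archimedean2 by blast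
          have ge: "real n / 4 \<le> (\<Sum>j<n. Re (s j p))"
          proof -
            have "1/4 \<le> Re (s j p)" for j
            proof -
              obtain a where a: "a \<in> A j" "dist p a \<le> e j" using net[OF True] by blast
              have "1/4 \<le> Re (of_real (e j) / (1 + of_real (e j) - cnj a * p))"
                using a nA p e by (intro peak_kernel_Re_ge) auto
              also have "\<dots> \<le> Re (s j p)"
                unfolding s_def Re_sum using a(1) A(1) p nA e
                by (intro member_le_sum peak_kernel_Re_nonneg) auto
              finally show ?thesis .
            qed
            then have "(\<Sum>j<n. 1/4) \<le> (\<Sum>j<n. Re (s j p))" by (intro sum_mono)
            then show ?thesis by simp
          qed
          have "continuous_on (cball 0 1) (\<lambda>z. \<Sum>j<n. Re (s j z))"
            by (intro continuous_intros s_cont)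
          moreover have "0 < real n / 8" using n r by (smt (verit) divide_pos_pos)
          ultimately obtain d where d: "d > 0"
            "\<And>z. z \<in> cball 0 1 \<Longrightarrow> dist z p < d \<Longrightarrow>
              dist (\<Sum>j<n. Re (s j z)) (\<Sum>j<n. Re (s j p)) < real n / 8"
            using p unfolding continuous_on_iff by meson
          have "dist (P z) (P p) < r" if z: "z \<in> cball 0 1" "dist z p < d" for z
          proof (cases "z \<in> K")
            case zK: False
            have "real n / 8 \<le> (\<Sum>j<n. Re (s j z))" using d(2)[OF z] ge by (auto simp: dist_real_def abs_if split: if_splits)
            then have "real n / 8 < Re (H z)" using H_ge[of z n] z zK by simp
            also have "\<dots> \<le> norm (H z)" by (rule complex_Re_le_cmod)
            finally have "1 / r < norm (H z)" using n by simp
            moreover have "0 < 1 / r" using r by simp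
            ultimately have "0 < norm (H z)" by linarith
            with \<open>1 / r < norm (H z)\<close> have "1 / norm (H z) < r" using r by (simp add: field_simps)
            then show ?thesis using True zK by (simp add: P_def norm_divide)
          qed (use True r in \<open>simp add: P_def\<close>)
          then show "\<exists>d>0. \<forall>z\<in>cball 0 1. dist z p < d \<longrightarrow> dist (P z) (P p) < r"
            using d(1) by blast
        qed
      qed
    qed
  qed
qed

section \<open>A Cantor set on the unit circle\<close>

text \<open>The Cayley transform, mapping the real line onto the unit circle without
  \<open>-1\<close>. Its chordal distances have a closed form, so distances on \<open>{0..1}\<close>
  and on the circle can be compared without trigonometry.\<close>

definition cayley_point :: "real \<Rightarrow> complex" where
  "cayley_point s = (1 + \<i> * of_real s) / (1 - \<i> * of_real s)"

lemma cayley_denominator: "1 - \<i> * of_real s \<noteq> 0" "1 \<le> norm (1 - \<i> * of_real s)"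
  "(norm (1 - \<i> * of_real s))\<^sup>2 = 1 + s\<^sup>2"
proof -
  show *: "(norm (1 - \<i> * of_real s))\<^sup>2 = 1 + s\<^sup>2" by (simp add: cmod_power2)
  then show "1 \<le> norm (1 - \<i> * of_real s)"
    using power2_le_imp_le[of 1 "norm (1 - \<i> * of_real s)"] by simp
  then show "1 - \<i> * of_real s \<noteq> 0" by auto
qed

lemma norm_cayley_point [simp]: "norm (cayley_point s) = 1"
proof -
  have "norm (1 + \<i> * of_real s) = norm (1 - \<i> * of_real s)" by (simp add: cmod_def)
  then show ?thesis using cayley_denominator(1)[of s] by (simp add: cayley_point_def norm_divide)
qed

lemma dist_cayley_point:
  "dist (cayley_point s) (cayley_point t) =
     2 * \<bar>s - t\<bar> / (norm (1 - \<i> * of_real s) * norm (1 - \<i> * of_real t))"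
proof -
  have "cayley_point s - cayley_point t =
      2 * \<i> * of_real (s - t) / ((1 - \<i> * of_real s) * (1 - \<i> * of_real t))"
    unfolding cayley_point_def using cayley_denominator(1)[of s] cayley_denominator(1)[of t]
    by (simp add: diff_frac_eq algebra_simps)
  then show ?thesis by (simp add: dist_norm norm_divide norm_mult flip: of_real_diff)
qed

text \<open>Both denominators have modulus at least 1. This bound carries nets from the line to the
  circle.\<close>

lemma dist_cayley_point_le: "dist (cayley_point s) (cayley_point t) \<le> 2 * \<bar>s - t\<bar>"
proof -
  have "1 * 1 \<le> norm (1 - \<i> * of_real s) * norm (1 - \<i> * of_real t)"
    by (intro mult_mono cayley_denominator(2)) auto
  then show ?thesis unfolding dist_cayley_point
    using divide_left_mono[of 1 "norm (1 - \<i> * of_real s) * norm (1 - \<i> * of_real t)" "2 * \<bar>s - t\<bar>"]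
    by (simp add: zero_less_mult_iff)
qed

text \<open>On \<open>{0..1}\<close> both denominators have modulus at most \<open>sqrt 2\<close>,
  so their product is at most the factor 2 in the numerator. This bound keeps separated pieces of
  the Cantor set apart on the circle.\<close>

lemma dist_cayley_point_ge:
  assumes "s \<in> {0..1}" "t \<in> {0..1}"
  shows "\<bar>s - t\<bar> \<le> dist (cayley_point s) (cayley_point t)"
proof -
  have le: "norm (1 - \<i> * of_real u) \<le> sqrt 2" if "u \<in> {0..1}" for u
    using that by (intro real_le_rsqrt) (auto simp: cayley_denominator(3) power_le_one)
  have "norm (1 - \<i> * of_real s) * norm (1 - \<i> * of_real t) \<le> sqrt 2 * sqrt 2"
    using assms by (intro mult_mono le) auto
  then have "norm (1 - \<i> * of_real s) * norm (1 - \<i> * of_real t) \<le> 2" by simp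
  moreover have "0 < norm (1 - \<i> * of_real s) * norm (1 - \<i> * of_real t)"
    using cayley_denominator(1) by simp
  ultimately have "2 * \<bar>s - t\<bar> / 2 \<le>
      2 * \<bar>s - t\<bar> / (norm (1 - \<i> * of_real s) * norm (1 - \<i> * of_real t))"
    by (intro divide_left_mono) auto
  then show ?thesis by (simp add: dist_cayley_point)
qed

text \<open>Base 4 expansions with digits 0 and 1 only. The at most \<open>2 ^ n\<close> truncations
  at depth \<open>n\<close> form a net at scale \<open>(1/4) ^ n\<close>, so count times scale is
  summable; and the tail after a position is worth at most a third of a digit at that position, so
  different sequences stay apart.\<close>

definition cantor_real :: "(nat \<Rightarrow> bool) \<Rightarrow> real" where
  "cantor_real b = (\<Sum>m. of_bool (b m) * (1/4) ^ Suc m)"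

lemma quarter_powers_sums: "(\<lambda>m. (1/4::real) ^ Suc (m + n)) sums ((1/4) ^ n / 3)"
proof -
  have "(\<lambda>m. (1/4) ^ Suc n * (1/4::real) ^ m) sums ((1/4) ^ Suc n * (1 / (1 - 1/4)))"
    by (intro sums_mult geometric_sums) simp
  then show ?thesis by (simp add: power_add mult_ac)
qed

lemma summable_bounded_quarter:
  fixes c :: "nat \<Rightarrow> real"
  assumes "\<And>m. \<bar>c m\<bar> \<le> 1"
  shows "summable (\<lambda>m. c m * (1/4) ^ Suc m)"
proof (rule summable_comparison_test)
  show "summable (\<lambda>m. (1/4::real) ^ Suc m)" using quarter_powers_sums[of 0] by (auto simp: sums_iff)
  show "\<exists>N. \<forall>n\<ge>N. norm (c n * (1/4) ^ Suc n) \<le> (1/4) ^ Suc n"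
    using assms by (auto simp: abs_mult intro!: mult_left_le_one_le)
qed

lemma cantor_real_diff:
  "(\<lambda>m. (of_bool (b m) - of_bool (c m)) * (1/4::real) ^ Suc m) sums (cantor_real b - cantor_real c)"
proof -
  have "(\<lambda>m. of_bool (b m) * (1/4::real) ^ Suc m) sums cantor_real b" for b
    unfolding cantor_real_def by (intro summable_sums summable_bounded_quarter) auto
  from sums_diff[OF this this] show ?thesis by (simp only: left_diff_distrib)
qed

text \<open>The common digits cancel, and the remaining ones are dominated by the geometric
  tail.\<close>

lemma cantor_real_agree:
  assumes "\<And>i. i < n \<Longrightarrow> b i = c i"
  shows "\<bar>cantor_real b - cantor_real c\<bar> \<le> (1/4) ^ n / 3"
proof -
  define f where "f = (\<lambda>m. (of_bool (b m) - of_bool (c m)) * (1/4::real) ^ Suc m)"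
  have f: "f sums (cantor_real b - cantor_real c)" unfolding f_def by (rule cantor_real_diff)
  have "(\<Sum>i<n. f i) = 0" using assms by (intro sum.neutral) (auto simp: f_def)
  then have f': "(\<lambda>m. f (m + n)) sums (cantor_real b - cantor_real c)"
    using sums_iff_shift'[of f n "cantor_real b - cantor_real c"] f by simp
  have "norm (\<Sum>m. f (m + n)) \<le> (\<Sum>m. (1/4) ^ Suc (m + n))"
  proof (rule norm_suminf_le)
    show "norm (f (m + n)) \<le> (1/4) ^ Suc (m + n)" for m
      by (auto simp: f_def abs_mult of_bool_def)
    show "summable (\<lambda>m. (1/4::real) ^ Suc (m + n))" using quarter_powers_sums by (rule sums_summable)
  qed
  then show ?thesis using sums_unique[OF f'] sums_unique[OF quarter_powers_sums[of n]] by simp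
qed

lemma cantor_real_range: "cantor_real b \<in> {0..1}"
proof -
  have "\<bar>cantor_real b - cantor_real (\<lambda>_. False)\<bar> \<le> (1/4) ^ 0 / 3" by (rule cantor_real_agree) auto
  moreover have "cantor_real (\<lambda>_. False) = 0" by (simp add: cantor_real_def)
  moreover have "0 \<le> cantor_real b"
    unfolding cantor_real_def by (intro suminf_nonneg summable_bounded_quarter) auto
  ultimately show ?thesis by simp
qed

text \<open>At the first difference \<open>i\<close> the value changes by
  \<open>(1/4) ^ Suc i\<close>, and all later digits together undo at most a third of that. Two
  thirds remain, which is more than the claimed half, and \<open>i <= j\<close> makes the bound at
  \<open>i\<close> at least as strong as the one at \<open>j\<close>.\<close>

lemma cantor_real_separated:
  assumes "b j \<noteq> c j"
  shows "(1/4) ^ Suc j / 2 \<le> \<bar>cantor_real b - cantor_real c\<bar>"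
proof -
  define i where "i = (LEAST i. b i \<noteq> c i)"
  have i: "b i \<noteq> c i" unfolding i_def using assms by (rule LeastI)
  have ij: "i \<le> j" unfolding i_def using assms by (rule Least_le)
  have eq: "b m = c m" if "m < i" for m using not_less_Least[of m "\<lambda>i. b i \<noteq> c i"] that by (auto simp: i_def)
  \<comment> \<open>\<open>c'\<close> agrees with \<open>b\<close> up to and including index
    \<open>i\<close> and with \<open>c\<close> everywhere except at \<open>i\<close>; it splits the
    difference into a tail and a single digit.\<close>
  define c' where "c' = c(i := b i)"
  have 1: "\<bar>cantor_real b - cantor_real c'\<bar> \<le> (1/4) ^ Suc i / 3"
    by (rule cantor_real_agree) (auto simp: c'_def less_Suc_eq eq)
  have "(\<lambda>m. if m = i then (of_bool (b i) - of_bool (c i)) * (1/4::real) ^ Suc i else 0)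
      sums (cantor_real c' - cantor_real c)"
    using cantor_real_diff[of c' c] by (rule sums_cong[THEN iffD1, rotated]) (auto simp: c'_def)
  then have eq': "cantor_real c' - cantor_real c = (of_bool (b i) - of_bool (c i)) * (1/4::real) ^ Suc i"
    using sums_single[of i "\<lambda>_. (of_bool (b i) - of_bool (c i)) * (1/4::real) ^ Suc i"] by (metis sums_unique2)
  then have 2: "\<bar>cantor_real c' - cantor_real c\<bar> = (1/4::real) ^ Suc i"
    unfolding eq' using i by (cases "b i"; cases "c i") auto
  have "(1/4::real) ^ Suc j \<le> (1/4) ^ Suc i" using ij by (intro power_decreasing) auto
  then show ?thesis using 1 2 by linarith
qed

definition cantor_point :: "(nat \<Rightarrow> bool) \<Rightarrow> complex" where
  "cantor_point b = cayley_point (cantor_real b)"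

lemma cantor_point_cball: "cantor_point b \<in> cball 0 1"
  by (simp add: cantor_point_def)

text \<open>Taking the closure makes the set closed by construction, so that compactness of the
  space of binary sequences need not be invoked.\<close>

definition cantor_cylinder :: "nat \<Rightarrow> bool \<Rightarrow> complex set" where
  "cantor_cylinder j v = closure (cantor_point ` {b. b j = v})"

lemma cantor_cylinder_sphere: "cantor_cylinder j v \<subseteq> sphere 0 1"
  unfolding cantor_cylinder_def by (intro closure_minimal) (auto simp: cantor_point_def)

text \<open>Before closure the two sets have a gap of at least \<open>r\<close>. A common closure
  point would have points of both sets within \<open>r / 2\<close>, hence two points less than
  \<open>r\<close> apart.\<close>

lemma cantor_cylinder_disjoint: "cantor_cylinder j True \<inter> cantor_cylinder j False = {}"
proof -
  define r :: real where "r = (1/4) ^ Suc j / 2"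
  have r: "r > 0" by (simp add: r_def)
  have *: "r \<le> dist p q"
    if pq: "p \<in> cantor_point ` {b. b j = True}" "q \<in> cantor_point ` {b. b j = False}" for p q
  proof -
    obtain b where b: "p = cantor_point b" "b j" using pq(1) by blast
    obtain c where c: "q = cantor_point c" "\<not> c j" using pq(2) by blast
    have "b j \<noteq> c j" using b c by simp
    then show ?thesis unfolding b(1) c(1)
      using cantor_real_separated[of b j c] dist_cayley_point_ge[OF cantor_real_range cantor_real_range, of b c]
      by (simp add: cantor_point_def r_def)
  qed
  have False if x: "x \<in> cantor_cylinder j True" "x \<in> cantor_cylinder j False" for x
  proof -
    obtain p where p: "p \<in> cantor_point ` {b. b j = True}" "dist x p < r/2"
      using closure_approachableD[OF x(1)[unfolded cantor_cylinder_def], of "r/2"] r by auto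
    obtain q where q: "q \<in> cantor_point ` {b. b j = False}" "dist x q < r/2"
      using closure_approachableD[OF x(2)[unfolded cantor_cylinder_def], of "r/2"] r by auto
    show False using *[OF p(1) q(1)] p(2) q(2) dist_triangle3[of p q x] by linarith
  qed
  then show ?thesis by blast
qed

section \<open>Finite nets of truncated sequences\<close>

lemma finitely_supported_bool:
  "finite {b :: nat \<Rightarrow> bool. \<forall>i\<ge>n. \<not> b i}" "card {b :: nat \<Rightarrow> bool. \<forall>i\<ge>n. \<not> b i} \<le> 2 ^ n"
proof -
  have sub: "{b :: nat \<Rightarrow> bool. \<forall>i\<ge>n. \<not> b i} \<subseteq> (\<lambda>S i. i \<in> S) ` Pow {..<n}"
  proof
    fix b :: "nat \<Rightarrow> bool" assume "b \<in> {b. \<forall>i\<ge>n. \<not> b i}"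
    then have "b = (\<lambda>i. i \<in> Collect b)" "Collect b \<in> Pow {..<n}" by (auto simp: not_le[symmetric])
    then show "b \<in> (\<lambda>S i. i \<in> S) ` Pow {..<n}" by blast
  qed
  then show "finite {b :: nat \<Rightarrow> bool. \<forall>i\<ge>n. \<not> b i}" by (rule finite_subset) auto
  have "card {b :: nat \<Rightarrow> bool. \<forall>i\<ge>n. \<not> b i} \<le> card ((\<lambda>S i. i \<in> S) ` Pow {..<n})"
    by (rule card_mono[OF _ sub]) auto
  also have "\<dots> \<le> card (Pow {..<n})" by (rule card_image_le) auto
  finally show "card {b :: nat \<Rightarrow> bool. \<forall>i\<ge>n. \<not> b i} \<le> 2 ^ n" by (simp add: card_Pow)
qed

text \<open>Fatou's construction is applied with the points of the truncated sequences as nets: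
  depth \<open>N n\<close> gives at most \<open>2 ^ N n\<close> points at scale
  \<open>(1/4) ^ N n\<close>.\<close>

lemma cantor_cylinder_zero_function:
  obtains P where "continuous_on (cball 0 1) P" "P holomorphic_on ball 0 1"
    "\<And>z. z \<in> cantor_cylinder j v \<Longrightarrow> P z = 0"
    "\<And>z. z \<in> cball 0 1 - cantor_cylinder j v \<Longrightarrow> Re (P z) > 0"
proof -
  \<comment> \<open>The offset \<open>Suc j\<close> keeps index \<open>j\<close> below the cut, so
    truncation preserves the digit that defines the cylinder.\<close>
  define N where "N n = n + Suc j" for n
  define B where "B n = {b :: nat \<Rightarrow> bool. b j = v \<and> (\<forall>i\<ge>N n. \<not> b i)}" for n
  have fin: "finite (B n)" for n
    by (rule finite_subset[OF _ finitely_supported_bool(1)[of "N n"]]) (auto simp: B_def)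
  show ?thesis
  proof (rule disk_function_with_zero_set[of "cantor_cylinder j v" "\<lambda>n. cantor_point ` B n" "\<lambda>n. (1/4) ^ N n"])
    show "cantor_cylinder j v \<subseteq> sphere 0 1" by (rule cantor_cylinder_sphere)
    show "closed (cantor_cylinder j v)" by (simp add: cantor_cylinder_def)
    show "finite (cantor_point ` B n)" for n using fin by simp
    show "cantor_point ` B n \<subseteq> cantor_cylinder j v" for n
      unfolding cantor_cylinder_def by (rule order_trans[OF _ closure_subset]) (auto simp: B_def)
    show "(0::real) < (1/4) ^ N n" for n by simp
    show "summable (\<lambda>n. real (card (cantor_point ` B n)) * (1/4) ^ N n)"
    proof (rule summable_comparison_test)
      show "summable (\<lambda>n. (1/2::real) ^ n)" by (simp add: summable_geometric)
      have "norm (real (card (cantor_point ` B n)) * (1/4) ^ N n) \<le> (1/2) ^ n" for n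
      proof -
        have "card (cantor_point ` B n) \<le> card (B n)" using fin by (rule card_image_le)
        also have "\<dots> \<le> card {b :: nat \<Rightarrow> bool. \<forall>i\<ge>N n. \<not> b i}"
          by (rule card_mono[OF finitely_supported_bool(1)]) (auto simp: B_def)
        also have "\<dots> \<le> 2 ^ N n" by (rule finitely_supported_bool(2))
        finally have "real (card (cantor_point ` B n)) \<le> 2 ^ N n" by (metis of_nat_le_iff of_nat_numeral of_nat_power)
        then have "real (card (cantor_point ` B n)) * (1/4) ^ N n \<le> 2 ^ N n * (1/4) ^ N n"
          by (intro mult_right_mono) auto
        also have "\<dots> = (1/2) ^ N n" by (simp add: power_mult_distrib[symmetric])
        also have "\<dots> \<le> (1/2) ^ n" by (intro power_decreasing) (auto simp: N_def)
        finally show ?thesis by simp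
      qed
      then show "\<exists>M. \<forall>n\<ge>M. norm (real (card (cantor_point ` B n)) * (1/4) ^ N n) \<le> (1/2) ^ n" by blast
    qed
    show "\<exists>a\<in>cantor_point ` B n. dist p a \<le> (1/4) ^ N n" if "p \<in> cantor_cylinder j v" for n p
    proof -
      \<comment> \<open>A finite union of closed balls is closed, so it suffices to cover the points
        before closure; each lies in the ball around its truncation.\<close>
      have "cantor_cylinder j v \<subseteq> (\<Union>a\<in>cantor_point ` B n. cball a ((1/4) ^ N n))"
        unfolding cantor_cylinder_def
      proof (rule closure_minimal)
        show "closed (\<Union>a\<in>cantor_point ` B n. cball a ((1/4) ^ N n))" using fin by (intro closed_UN) auto
        show "cantor_point ` {b. b j = v} \<subseteq> (\<Union>a\<in>cantor_point ` B n. cball a ((1/4) ^ N n))"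
        proof
          fix p assume "p \<in> cantor_point ` {b. b j = v}"
          then obtain b where b: "p = cantor_point b" and v: "v = b j" by blast
          define c where "c i = (b i \<and> i < N n)" for i
          have c: "c \<in> B n" using v by (auto simp: c_def B_def N_def)
          have "\<bar>cantor_real c - cantor_real b\<bar> \<le> (1/4) ^ N n / 3"
            by (rule cantor_real_agree) (auto simp: c_def)
          then have "dist (cantor_point c) (cantor_point b) \<le> 2 * ((1/4) ^ N n / 3)"
            unfolding cantor_point_def by (intro order_trans[OF dist_cayley_point_le mult_left_mono]) auto
          also have "\<dots> \<le> (1/4) ^ N n" by simp
          finally show "p \<in> (\<Union>a\<in>cantor_point ` B n. cball a ((1/4) ^ N n))" using c b by auto
        qed
      qed
      from subsetD[OF this that] show ?thesis by (auto simp: dist_commute)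
    qed
  qed (rule that)
qed

section \<open>Switch functions with values in the upper half plane\<close>

text \<open>Fourth roots of numbers in the right half plane have arguments between
  \<open>-pi/8\<close> and \<open>pi/8\<close>. So one root times the conjugate of the other has
  argument between \<open>-pi/4\<close> and \<open>pi/4\<close>, and the rotation by
  \<open>pi/4\<close> moves it into the open first quadrant.\<close>

lemma quarter_power_sector:
  assumes "0 < Re p" "0 < Re q"
  defines "w \<equiv> exp (\<i> * of_real (pi/4)) * p powr (1/4) * cnj (q powr (1/4))"
  shows "0 < Re w" "0 < Im w"
proof -
  have nz: "p \<noteq> 0" "q \<noteq> 0" using assms by auto
  have "w = exp (\<i> * of_real (pi/4) + Ln p / 4 + cnj (Ln q / 4))"
    using nz by (simp add: w_def powr_def exp_add exp_cnj)
  then have w: "Re w = exp (Re (Ln p) / 4 + Re (Ln q) / 4) * cos (pi/4 + Im (Ln p) / 4 - Im (Ln q) / 4)"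
    "Im w = exp (Re (Ln p) / 4 + Re (Ln q) / 4) * sin (pi/4 + Im (Ln p) / 4 - Im (Ln q) / 4)"
    by (simp_all add: Re_exp Im_exp)
  have "\<bar>Im (Ln p)\<bar> < pi/2" "\<bar>Im (Ln q)\<bar> < pi/2" using Re_Ln_pos_lt nz assms(1,2) by auto
  then have "0 < pi/4 + Im (Ln p) / 4 - Im (Ln q) / 4" "pi/4 + Im (Ln p) / 4 - Im (Ln q) / 4 < pi/2"
    by linarith+
  then show "0 < Re w" "0 < Im w"
    unfolding w by (auto intro!: mult_pos_pos cos_gt_zero sin_gt_zero)
qed

text \<open>Both facts come from expanding with \<open>a * cnj b\<close>: its real part makes
  \<open>norm (a + b)\<close> at least \<open>norm a\<close>, and since
  \<open>a * cnj (a + b)\<close> differs from \<open>a * cnj b\<close> by a real number, its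
  imaginary part alone determines the sign of the imaginary part of the ratio.\<close>

lemma sector_ratio:
  fixes a b :: complex
  assumes nz: "a \<noteq> 0 \<or> b \<noteq> 0" and re: "0 \<le> Re (a * cnj b)"
  shows "a + b \<noteq> 0" "norm (a / (a + b)) \<le> 1" "0 \<le> Im (a * cnj b) \<Longrightarrow> 0 \<le> Im (a / (a + b))"
    "0 < Im (a * cnj b) \<Longrightarrow> 0 < Im (a / (a + b))"
proof -
  have sq: "(norm (a + b))\<^sup>2 = (norm a)\<^sup>2 + (norm b)\<^sup>2 + 2 * Re (a * cnj b)"
    unfolding cmod_power2 by (simp add: power2_eq_square algebra_simps)
  moreover have "(norm a)\<^sup>2 + (norm b)\<^sup>2 > 0" using nz by (auto simp: sum_power2_gt_zero_iff)
  ultimately have pos: "(norm (a + b))\<^sup>2 > 0" using re by linarith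
  then show ab: "a + b \<noteq> 0" by auto
  have "norm a \<le> norm (a + b)" by (rule power2_le_imp_le) (use sq re in auto)
  then show "norm (a / (a + b)) \<le> 1" using ab by (simp add: norm_divide)
  have im: "Im (a / (a + b)) = Im (a * cnj b) / (norm (a + b))\<^sup>2"
    unfolding Im_divide cmod_power2 by (simp add: algebra_simps)
  show "0 \<le> Im (a * cnj b) \<Longrightarrow> 0 \<le> Im (a / (a + b))" unfolding im by simp
  show "0 < Im (a * cnj b) \<Longrightarrow> 0 < Im (a / (a + b))" unfolding im using pos by simp
qed

text \<open>In \<open>h = a / (a + b)\<close> the numerator vanishes on the cylinder of
  \<open>False\<close> and \<open>b\<close> vanishes on that of \<open>True\<close>, which gives the
  values 0 and 1; disjointness of the cylinders excludes common zeros. Strict positivity inside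
  holds because the cylinders lie on the circle.\<close>

lemma cantor_switch:
  obtains h where "continuous_on (cball 0 1) h" "h holomorphic_on ball 0 1"
    "\<And>z. z \<in> cball 0 1 \<Longrightarrow> norm (h z) \<le> 1" "\<And>z. z \<in> cball 0 1 \<Longrightarrow> 0 \<le> Im (h z)"
    "\<And>z. z \<in> ball 0 1 \<Longrightarrow> 0 < Im (h z)" "\<And>b. h (cantor_point b) = of_bool (b j)"
proof -
  obtain P where P: "continuous_on (cball 0 1) P" "P holomorphic_on ball 0 1"
    "\<And>z. z \<in> cantor_cylinder j False \<Longrightarrow> P z = 0"
    "\<And>z. z \<in> cball 0 1 - cantor_cylinder j False \<Longrightarrow> Re (P z) > 0"
    by (rule cantor_cylinder_zero_function[where j = j and v = False]) (rule that)
  obtain Q where Q: "continuous_on (cball 0 1) Q" "Q holomorphic_on ball 0 1"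
    "\<And>z. z \<in> cantor_cylinder j True \<Longrightarrow> Q z = 0"
    "\<And>z. z \<in> cball 0 1 - cantor_cylinder j True \<Longrightarrow> Re (Q z) > 0"
    by (rule cantor_cylinder_zero_function[where j = j and v = True]) (rule that)
  define a where "a z = exp (\<i> * of_real (pi/4)) * P z powr (1/4)" for z
  define b where "b z = Q z powr (1/4)" for z
  define h where "h z = a z / (a z + b z)" for z
  have P0: "0 < Re (P z) \<or> P z = 0" "0 < Re (Q z) \<or> Q z = 0" if "z \<in> cball 0 1" for z
    using P(3,4) Q(3,4) that by blast+
  have nz: "P z \<noteq> 0 \<or> Q z \<noteq> 0" if "z \<in> cball 0 1" for z
    using P(4)[of z] Q(4)[of z] that cantor_cylinder_disjoint[of j] by fastforce
  have nz': "a z \<noteq> 0 \<or> b z \<noteq> 0" if "z \<in> cball 0 1" for z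
    using nz[OF that] by (auto simp: a_def b_def)
  have sec: "0 \<le> Re (a z * cnj (b z))" "0 \<le> Im (a z * cnj (b z))" if "z \<in> cball 0 1" for z
  proof -
    have "0 \<le> Re (a z * cnj (b z)) \<and> 0 \<le> Im (a z * cnj (b z))"
    proof (cases "P z = 0 \<or> Q z = 0")
      case False
      then show ?thesis using quarter_power_sector[of "P z" "Q z"] P0[OF that]
        by (auto simp: a_def b_def intro: less_imp_le)
    qed (auto simp: a_def b_def)
    then show "0 \<le> Re (a z * cnj (b z))" "0 \<le> Im (a z * cnj (b z))" by auto
  qed
  have ballP: "0 < Re (P z)" "0 < Re (Q z)" if "z \<in> ball 0 1" for z
    using P(4)[of z] Q(4)[of z] that cantor_cylinder_sphere[of j] by fastforce+
  have in_cyl: "cantor_point c \<in> cantor_cylinder j (c j)" for c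
    unfolding cantor_cylinder_def by (rule subsetD[OF closure_subset]) auto
  show ?thesis
  proof
    show "norm (h z) \<le> 1" "0 \<le> Im (h z)" if "z \<in> cball 0 1" for z
      unfolding h_def using sector_ratio[OF nz'[OF that] sec(1)[OF that]] sec(2)[OF that] by auto
    show "0 < Im (h z)" if "z \<in> ball 0 1" for z
    proof -
      have z: "z \<in> cball 0 1" using that by simp
      have "0 < Im (a z * cnj (b z))" unfolding a_def b_def by (intro quarter_power_sector ballP that)
      then show ?thesis unfolding h_def using sector_ratio(4)[OF nz'[OF z] sec(1)[OF z]] by blast
    qed
    \<comment> \<open>The principal power is continuous off the open negative real axis; at zeros of
      the base, continuity comes from the positive exponent.\<close>
    have "cball 0 1 \<subseteq> {z. 0 \<le> Re (P z) \<or> Im (P z) \<noteq> 0}" "cball 0 1 \<subseteq> {z. 0 \<le> Re (Q z) \<or> Im (Q z) \<noteq> 0}"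
      using P0 by (force intro: less_imp_le)+
    then show "continuous_on (cball 0 1) h"
      unfolding h_def using sector_ratio(1)[OF nz' sec(1)] unfolding a_def b_def
      by (intro continuous_intros P Q) auto
    have "P z \<notin> \<real>\<^sub>\<le>\<^sub>0" "Q z \<notin> \<real>\<^sub>\<le>\<^sub>0" if "z \<in> ball 0 1" for z
      using ballP[OF that] by (auto simp: complex_nonpos_Reals_iff)
    moreover have "a z + b z \<noteq> 0" if "z \<in> ball 0 1" for z
      using sector_ratio(1)[OF nz' sec(1), of z] that by simp
    ultimately show "h holomorphic_on ball 0 1"
      unfolding h_def a_def b_def by (intro holomorphic_intros P Q) auto
    show "h (cantor_point c) = of_bool (c j)" for c
    proof (cases "c j")
      case True
      have z: "cantor_point c \<in> cball 0 1" by (simp add: cantor_point_def)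
      have "Q (cantor_point c) = 0" using Q(3) in_cyl[of c] True by simp
      then have "b (cantor_point c) = 0" by (simp add: b_def)
      then show ?thesis using nz'[OF z] True by (simp add: h_def)
    next
      case False
      then have "P (cantor_point c) = 0" using P(3) in_cyl[of c] by simp
      then show ?thesis using False by (simp add: h_def a_def)
    qed
  qed
qed

section \<open>A disk curve through every point of the torus\<close>

text \<open>Doubling turns \<open>floor (2^n * t)\<close> into twice itself plus the next digit, so
  the first \<open>n\<close> digits sum to \<open>floor (2^n * t) / 2^n\<close>, which is within
  \<open>(1/2) ^ n\<close> of \<open>t\<close>. The induction starts from
  \<open>floor t = 0\<close>.\<close>

lemma binary_expansion_sums:
  fixes t :: real
  assumes t: "0 \<le> t" "t < 1"
  shows "(\<lambda>j. (1/2) ^ Suc j * of_bool (odd \<lfloor>2 ^ Suc j * t\<rfloor>)) sums t"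
proof -
  have double: "\<lfloor>2 * x\<rfloor> = 2 * \<lfloor>x\<rfloor> + of_bool (odd \<lfloor>2 * x\<rfloor>)" for x :: real
  proof -
    have "\<lfloor>2 * x\<rfloor> = 2 * \<lfloor>x\<rfloor> \<or> \<lfloor>2 * x\<rfloor> = 2 * \<lfloor>x\<rfloor> + 1" by linarith
    then show ?thesis by auto
  qed
  have partial: "(\<Sum>j<n. (1/2) ^ Suc j * of_bool (odd \<lfloor>2 ^ Suc j * t\<rfloor>)) = (of_int \<lfloor>2 ^ n * t\<rfloor> * (1/2) ^ n :: real)" for n
  proof (induction n)
    case 0
    have "\<lfloor>t\<rfloor> = 0" using t by linarith
    then show ?case by simp
  next
    case (Suc n)
    have "of_int \<lfloor>2 ^ Suc n * t\<rfloor> = 2 * of_int \<lfloor>2 ^ n * t\<rfloor> + (of_bool (odd \<lfloor>2 ^ Suc n * t\<rfloor>) :: real)"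
      using arg_cong[OF double[of "2 ^ n * t"], of real_of_int] by (simp add: mult.assoc)
    moreover have "(2 * a + b) * (1/2) ^ Suc n = a * (1/2) ^ n + (1/2) ^ Suc n * b" for a b :: real
      by (simp add: algebra_simps)
    ultimately show ?case using Suc.IH by simp
  qed
  have "(\<lambda>n. of_int \<lfloor>2 ^ n * t\<rfloor> * (1/2) ^ n) \<longlonglongrightarrow> t"
  proof (rule LIMSEQ_I)
    fix r :: real assume "0 < r"
    then obtain N where N: "(1/2::real) ^ N < r" using real_arch_pow_inv[of r "1/2"] by auto
    have "norm (of_int \<lfloor>2 ^ n * t\<rfloor> * (1/2) ^ n - t) < r" if n: "N \<le> n" for n
    proof -
      have "t = (2 ^ n * t) * (1/2) ^ n" by (simp add: power_one_over)
      then have "of_int \<lfloor>2 ^ n * t\<rfloor> * (1/2) ^ n - t = (of_int \<lfloor>2 ^ n * t\<rfloor> - 2 ^ n * t) * (1/2) ^ n"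
        by (simp add: left_diff_distrib)
      also have "norm \<dots> \<le> 1 * (1/2) ^ n"
        unfolding norm_mult norm_power by (intro mult_mono) (auto simp: abs_if, linarith+)
      also have "\<dots> \<le> (1/2) ^ N" using n by (simp add: power_decreasing)
      finally show ?thesis using N by simp
    qed
    then show "\<exists>N. \<forall>n\<ge>N. norm (of_int \<lfloor>2 ^ n * t\<rfloor> * (1/2) ^ n - t) < r" by blast
  qed
  then show ?thesis by (simp only: sums_def partial)
qed

text \<open>On the Cantor set each \<open>G k\<close> is a binary series with freely chosen digits,
  so \<open>F k\<close> reaches any unimodular value, for all \<open>k\<close> at once. The strict
  bound inside the disk later keeps its image in the open polydisk.\<close>

lemma disk_curve_through_torus:
  obtains F :: "nat \<Rightarrow> complex \<Rightarrow> complex" where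
    "\<And>k. continuous_on (cball 0 1) (F k)" "\<And>k. F k holomorphic_on ball 0 1"
    "\<And>k z. z \<in> cball 0 1 \<Longrightarrow> norm (F k z) \<le> 1" "\<And>k z. z \<in> ball 0 1 \<Longrightarrow> norm (F k z) < 1"
    "\<And>w. \<forall>k. norm (w k) = 1 \<Longrightarrow> \<exists>z\<in>cball 0 1. \<forall>k. F k z = w k"
proof -
  have "\<exists>h. continuous_on (cball 0 1) h \<and> h holomorphic_on ball 0 1 \<and>
      (\<forall>z\<in>cball 0 1. norm (h z) \<le> 1 \<and> 0 \<le> Im (h z)) \<and> (\<forall>z\<in>ball 0 1. 0 < Im (h z)) \<and>
      (\<forall>b. h (cantor_point b) = of_bool (b j))" for j
    by (rule cantor_switch[of j], rule exI, intro conjI ballI allI) 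
  then obtain h where h: "continuous_on (cball 0 1) (h j)" "(h j) holomorphic_on ball 0 1"
    and hcb: "\<forall>z\<in>cball 0 1. norm (h j z) \<le> 1 \<and> 0 \<le> Im (h j z)" and hb: "\<forall>z\<in>ball 0 1. 0 < Im (h j z)"
    and hx: "\<forall>b. h j (cantor_point b) = of_bool (b j)" for j by metis
  \<comment> \<open>\<open>prod_encode\<close> splits the single bit sequence of a Cantor point into
    countably many independent sequences, one for each coordinate \<open>k\<close>.\<close>
  define g where "g k j z = (1/2) ^ Suc j * h (prod_encode (k, j)) z" for k j z
  define G where "G k z = (\<Sum>j. g k j z)" for k z
  define F where "F k z = exp (2 * of_real pi * \<i> * G k z)" for k z
  have g_norm: "norm (g k j z) \<le> (1/2) ^ Suc j" if "z \<in> cball 0 1" for k j z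
  proof -
    have "norm (g k j z) = (1/2) ^ Suc j * norm (h (prod_encode (k, j)) z)"
      by (simp add: g_def norm_mult norm_power)
    also have "\<dots> \<le> (1/2) ^ Suc j * 1" using hcb that by (intro mult_left_mono) auto
    finally show ?thesis by simp
  qed
  have sm: "summable (\<lambda>j. (1/2::real) ^ Suc j)" by (simp add: summable_geometric)
  have g_sums: "(\<lambda>j. g k j z) sums G k z" if "z \<in> cball 0 1" for k z
    unfolding G_def using g_norm[OF that] by (intro summable_sums summable_comparison_test'[OF sm])
  have ul: "uniform_limit (cball 0 1) (\<lambda>n z. \<Sum>j<n. g k j z) (G k) sequentially" for k
    unfolding G_def by (rule Weierstrass_m_test[OF g_norm sm])
  have G: "continuous_on (cball 0 1) (G k) \<and> G k holomorphic_on ball 0 1" for k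
  proof -
    have *: "continuous_on (cball 0 1) (\<lambda>z. \<Sum>j<n. g k j z)" "(\<lambda>z. \<Sum>j<n. g k j z) holomorphic_on ball 0 1" for n
      unfolding g_def by (intro continuous_intros holomorphic_intros h)+
    show ?thesis
      by (rule holomorphic_uniform_limit[OF always_eventually ul[of k]]) (use * in auto)
  qed
  have Im_g: "Im (g k j z) = (1/2) ^ Suc j * Im (h (prod_encode (k, j)) z)" for k j z
  proof -
    have "g k j z = of_real ((1/2) ^ Suc j) * h (prod_encode (k, j)) z" by (simp add: g_def)
    then show ?thesis by (simp only: Im_complex_of_real Re_complex_of_real times_complex.sel)
  qed
  have Im_G: "(\<lambda>j. Im (g k j z)) sums Im (G k z)" if "z \<in> cball 0 1" for k z
    using g_sums[OF that] by (rule sums_Im)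
  have norm_F: "norm (F k z) = exp (- (2 * pi * Im (G k z)))" for k z
    by (simp add: F_def norm_exp_eq_Re)
  show ?thesis
  proof
    show "continuous_on (cball 0 1) (F k)" "F k holomorphic_on ball 0 1" for k
      unfolding F_def using G by (auto intro!: continuous_intros holomorphic_intros)
    show "norm (F k z) \<le> 1" if "z \<in> cball 0 1" for k z
    proof -
      have "0 \<le> (\<Sum>j. Im (g k j z))"
        using hcb that by (intro suminf_nonneg sums_summable[OF Im_G]) (auto simp: Im_g)
      then show ?thesis unfolding norm_F sums_unique[OF Im_G[OF that]] by simp
    qed
    show "norm (F k z) < 1" if "z \<in> ball 0 1" for k z
    proof -
      have z: "z \<in> cball 0 1" using that by simp
      have "0 < (\<Sum>j. Im (g k j z))"
        using hb that z by (intro suminf_pos sums_summable[OF Im_G]) (auto simp: Im_g)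
      then show ?thesis unfolding norm_F sums_unique[OF Im_G[OF z]] by simp
    qed
    fix w :: "nat \<Rightarrow> complex" assume w: "\<forall>k. norm (w k) = 1"
    \<comment> \<open>The argument of \<open>w k\<close> measured in full turns, so that it lies in
      the range required for a binary expansion.\<close>
    define t where "t k = Arg2pi (w k) / (2 * pi)" for k
    have t: "0 \<le> t k" "t k < 1" for k using Arg2pi[of "w k"] by (auto simp: t_def)
    define b where "b n = (case prod_decode n of (k, j) \<Rightarrow> odd \<lfloor>2 ^ Suc j * t k\<rfloor>)" for n
    have "F k (cantor_point b) = w k" for k
    proof -
      have "(\<lambda>j. of_real ((1/2) ^ Suc j * of_bool (odd \<lfloor>2 ^ Suc j * t k\<rfloor>))) sums (of_real (t k) :: complex)"
        by (intro sums_of_real binary_expansion_sums t)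
      then have "(\<lambda>j. g k j (cantor_point b)) sums of_real (t k)"
        using hx by (simp add: g_def b_def of_bool_def if_distrib[of complex_of_real] cong: if_cong)
      then have "G k (cantor_point b) = of_real (t k)"
        using g_sums[OF cantor_point_cball] by (rule sums_unique2[symmetric])
      then have "F k (cantor_point b) = exp (\<i> * of_real (Arg2pi (w k)))"
        by (simp add: F_def t_def mult_ac)
      also have "\<dots> = w k" using Arg2pi_eq[of "w k"] w by simp
      finally show ?thesis .
    qed
    then show "\<exists>z\<in>cball 0 1. \<forall>k. F k z = w k" using cantor_point_cball by blast
  qed
qed

section \<open>Subalgebras from norm-preserving pullbacks\<close>

lemma unital_subalgebraD:
  assumes "unital_subalgebra K B A"
  shows "A \<subseteq> B" "(\<lambda>x\<in>K. 1) \<in> A"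
    "\<And>f g. f \<in> A \<Longrightarrow> g \<in> A \<Longrightarrow> (\<lambda>x\<in>K. f x + g x) \<in> A"
    "\<And>f g. f \<in> A \<Longrightarrow> g \<in> A \<Longrightarrow> (\<lambda>x\<in>K. f x * g x) \<in> A"
    "\<And>c f. f \<in> A \<Longrightarrow> (\<lambda>x\<in>K. c * f x) \<in> A"
  using assms unfolding unital_subalgebra_def by blast+

lemma unital_subalgebraI:
  assumes "A \<subseteq> B" "(\<lambda>x\<in>K. 1) \<in> A"
    "\<And>f g. f \<in> A \<Longrightarrow> g \<in> A \<Longrightarrow> (\<lambda>x\<in>K. f x + g x) \<in> A"
    "\<And>f g. f \<in> A \<Longrightarrow> g \<in> A \<Longrightarrow> (\<lambda>x\<in>K. f x * g x) \<in> A"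
    "\<And>c f. f \<in> A \<Longrightarrow> (\<lambda>x\<in>K. c * f x) \<in> A"
  shows "unital_subalgebra K B A"
  unfolding unital_subalgebra_def by (intro conjI ballI allI assms)

lemma uniformly_closedD:
  assumes "uniformly_closed K A" "\<And>m. F m \<in> A" "f \<in> extensional K" "uniform_limit K F f sequentially"
  shows "f \<in> A"
  using assms unfolding uniformly_closed_def by blast

section \<open>Maximum principle on the infinite polydisk\<close>

lemma continuous_on_fun_upd:
  fixes z :: "'a \<Rightarrow> 'b::topological_space"
  shows "continuous_on S (\<lambda>t. z(k := t))"
proof (rule continuous_on_coordinatewise_then_product)
  show "continuous_on S (\<lambda>t. (z(k := t)) i)" for i by (cases "i = k") auto
qed

lemma fun_upd_infinite_polydisk:
  "z \<in> infinite_polydisk \<Longrightarrow> norm t \<le> 1 \<Longrightarrow> z(k := t) \<in> infinite_polydisk"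
  by (simp add: infinite_polydisk_def)

lemma tendsto_fun_coordinatewise:
  fixes f :: "'a \<Rightarrow> 'b \<Rightarrow> 'c::topological_space"
  assumes "\<And>i. ((\<lambda>n. f n i) \<longlongrightarrow> l i) F"
  shows "(f \<longlongrightarrow> l) F"
proof -
  have "limitin (product_topology (\<lambda>_. euclidean) UNIV) f l F"
    unfolding limitin_componentwise using assms by (simp add: limitin_canonical_iff)
  then show ?thesis by (simp add: euclidean_product_topology limitin_canonical_iff)
qed

text \<open>
  Replacing one coordinate after the other by a unimodular one does not decrease \<open>\<bar>f\<bar>\<close>;
  the limit of this process is a point of the torus.
\<close>

lemma infinite_polydisk_maximum_on_torus:
  fixes f :: "(nat \<Rightarrow> complex) \<Rightarrow> complex"
  assumes cont: "continuous_on infinite_polydisk f"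
    and slice: "\<And>k z. z \<in> infinite_polydisk \<Longrightarrow> (\<lambda>t. f (z(k := t))) holomorphic_on ball 0 1"
    and z: "z \<in> infinite_polydisk"
  obtains w where "\<And>k. norm (w k) = 1" "norm (f z) \<le> norm (f w)"
proof -
  note upd = fun_upd_infinite_polydisk
  \<comment> \<open>The one-variable maximum modulus principle on the slice in coordinate
    \<open>k\<close>: compactness of the circle supplies the maximiser \<open>t\<close>, and
    \<open>x\<close> itself is the point of the slice with parameter \<open>x k\<close>.\<close>
  have step: "\<exists>t. norm t = 1 \<and> norm (f x) \<le> norm (f (x(k := t)))" if x: "x \<in> infinite_polydisk" for x k
  proof -
    have cs: "continuous_on (cball 0 1) (\<lambda>t. f (x(k := t)))"
      by (rule continuous_on_compose2[OF cont continuous_on_fun_upd]) (use upd[OF x] in auto)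
    have "continuous_on (sphere 0 1) (\<lambda>t. norm (f (x(k := t))))"
      by (intro continuous_on_norm continuous_on_subset[OF cs]) auto
    then obtain t :: complex where t: "t \<in> sphere 0 1"
      "\<And>s. s \<in> sphere 0 1 \<Longrightarrow> norm (f (x(k := s))) \<le> norm (f (x(k := t)))"
      using continuous_attains_sup[of "sphere 0 1" "\<lambda>t. norm (f (x(k := t)))"] by auto
    have "norm (f (x(k := x k))) \<le> norm (f (x(k := t)))"
    proof (rule maximum_modulus_frontier[where f = "\<lambda>t. f (x(k := t))" and S = "cball 0 1"])
      show "(\<lambda>t. f (x(k := t))) holomorphic_on interior (cball 0 1)" using slice[OF x] by simp
      show "continuous_on (closure (cball 0 1)) (\<lambda>t. f (x(k := t)))" using cs by simp
      show "norm (f (x(k := s))) \<le> norm (f (x(k := t)))" if "s \<in> frontier (cball 0 1)" for s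
        using t(2) that by (simp add: frontier_cball)
      show "x k \<in> cball 0 1" using x by (auto simp: infinite_polydisk_def)
    qed simp
    then show ?thesis using t(1) by auto
  qed
  define T where "T x k = (SOME t. norm t = 1 \<and> norm (f x) \<le> norm (f (x(k := t))))" for x k
  have T: "norm (T x k) = 1" "norm (f x) \<le> norm (f (x(k := T x k)))" if "x \<in> infinite_polydisk" for x k
    using someI_ex[OF step[OF that, of k]] by (auto simp: T_def)
  define x where "x = rec_nat z (\<lambda>n y. y(n := T y n))"
  have x_Suc: "x (Suc n) = (x n)(n := T (x n) n)" for n by (simp add: x_def)
  have x_in: "x n \<in> infinite_polydisk" for n
  proof (induction n)
    case (Suc n)
    then show ?case unfolding x_Suc by (intro upd) (auto simp: T)
  qed (simp add: x_def z)
  have x_le: "norm (f z) \<le> norm (f (x n))" for n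
  proof (induction n)
    case (Suc n)
    then show ?case unfolding x_Suc by (rule order_trans[OF _ T(2)[OF x_in]])
  qed (simp add: x_def)
  define w where "w k = x (Suc k) k" for k
  have w: "norm (w k) = 1" for k using T(1)[OF x_in] by (simp add: w_def x_Suc)
  \<comment> \<open>Only step \<open>k\<close> touches coordinate \<open>k\<close>, so that
    coordinate is frozen from index \<open>Suc k\<close> on.\<close>
  have x_w: "x n k = w k" if "Suc k \<le> n" for n k
    using that by (induction n rule: dec_induct) (auto simp: w_def x_Suc)
  have "x \<longlonglongrightarrow> w"
  proof (rule tendsto_fun_coordinatewise)
    show "(\<lambda>n. x n k) \<longlonglongrightarrow> w k" for k
      by (rule tendsto_eventually) (use x_w in \<open>auto simp: eventually_sequentially\<close>)
  qed
  moreover have "w \<in> infinite_polydisk" using w by (simp add: infinite_polydisk_def)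
  ultimately have "(\<lambda>n. norm (f (x n))) \<longlonglongrightarrow> norm (f w)"
    using x_in by (intro tendsto_norm continuous_on_tendsto_compose[OF cont]) auto
  then have "norm (f z) \<le> norm (f w)"
    by (rule LIMSEQ_le_const) (use x_le in auto)
  with w show ?thesis by (rule that)
qed

section \<open>Pullback along a norm-attaining map\<close>

text \<open>Applied to differences, \<open>attained\<close> together with \<open>\<phi>\<close>
  mapping into \<open>K\<close> makes the pullback \<open>R\<close> an isometry for the supremum
  norms. Hence it is injective, and its image is closed because \<open>B\<close> is.\<close>

lemma closed_subalgebra_by_pullback:
  fixes K :: "'b set" and B :: "('b \<Rightarrow> complex) set" and \<phi> :: "complex \<Rightarrow> 'b"
  assumes alg: "unital_subalgebra K C B" and closed: "uniformly_closed K B" and ext: "B \<subseteq> extensional K"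
    and \<phi>: "\<And>z. z \<in> cball 0 1 \<Longrightarrow> \<phi> z \<in> K"
    and pull: "\<And>f. f \<in> B \<Longrightarrow> (\<lambda>z\<in>cball 0 1. f (\<phi> z)) \<in> disk_algebra"
    and attained: "\<And>f x. f \<in> B \<Longrightarrow> x \<in> K \<Longrightarrow> \<exists>z\<in>cball 0 1. norm (f x) \<le> norm (f (\<phi> z))"
  shows "\<exists>A. unital_subalgebra (cball 0 1) disk_algebra A \<and> uniformly_closed (cball 0 1) A \<and>
    algebra_isomorphic (cball 0 1) A K B"
proof -
  define R where "R f = (\<lambda>z\<in>cball 0 1. f (\<phi> z))" for f :: "'b \<Rightarrow> complex"
  define A where "A = R ` B"
  note B = unital_subalgebraD(2-5)[OF alg]
  have R_one: "R (\<lambda>x\<in>K. 1) = (\<lambda>z\<in>cball 0 1. 1)"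
    and R_add: "R (\<lambda>x\<in>K. f x + g x) = (\<lambda>z\<in>cball 0 1. R f z + R g z)"
    and R_mult: "R (\<lambda>x\<in>K. f x * g x) = (\<lambda>z\<in>cball 0 1. R f z * R g z)"
    and R_scale: "R (\<lambda>x\<in>K. c * f x) = (\<lambda>z\<in>cball 0 1. c * R f z)" for f g c
    using \<phi> by (auto simp: R_def fun_eq_iff restrict_def)
  \<comment> \<open>The difference is built from the algebra operations, so it lies in
    \<open>B\<close> and \<open>attained\<close> applies to it.\<close>
  have isom: "\<exists>z\<in>cball 0 1. norm (f x - g x) \<le> norm (R f z - R g z)" if "f \<in> B" "g \<in> B" "x \<in> K" for f g x
  proof -
    define d where "d = (\<lambda>x\<in>K. f x + (\<lambda>x\<in>K. (-1) * g x) x)"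
    have "d \<in> B" unfolding d_def using that by (intro B)
    then obtain z where "z \<in> cball 0 1" "norm (d x) \<le> norm (d (\<phi> z))" using attained \<open>x \<in> K\<close> by blast
    then show ?thesis using \<phi> \<open>x \<in> K\<close> by (intro bexI[of _ z]) (auto simp: d_def R_def)
  qed
  have inj: "inj_on R B"
  proof (rule inj_onI)
    fix f g assume fg: "f \<in> B" "g \<in> B" "R f = R g"
    have "f x = g x" if "x \<in> K" for x using isom[OF fg(1,2) that] fg(3) by auto
    moreover have "f \<in> extensional K" "g \<in> extensional K" using fg ext by auto
    ultimately show "f = g" by (intro extensionalityI) 
  qed
  have "unital_subalgebra (cball 0 1) disk_algebra A"
    unfolding unital_subalgebra_def
  proof (intro conjI ballI allI)
    show "A \<subseteq> disk_algebra" using pull by (auto simp: A_def R_def)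
    show "(\<lambda>z\<in>cball 0 1. 1) \<in> A" unfolding A_def R_one[symmetric] by (intro imageI B)
    fix u v c assume "u \<in> A" 
    then obtain f where f: "f \<in> B" "u = R f" by (auto simp: A_def)
    show "(\<lambda>z\<in>cball 0 1. c * u z) \<in> A" unfolding A_def f R_scale[symmetric] by (intro imageI B f)
    assume "v \<in> A"
    then obtain g where g: "g \<in> B" "v = R g" by (auto simp: A_def)
    show "(\<lambda>z\<in>cball 0 1. u z + v z) \<in> A" unfolding A_def f g R_add[symmetric] by (intro imageI B f g)
    show "(\<lambda>z\<in>cball 0 1. u z * v z) \<in> A" unfolding A_def f g R_mult[symmetric] by (intro imageI B f g)
  qed
  moreover have "uniformly_closed (cball 0 1) A"
    unfolding uniformly_closed_def
  proof (intro allI impI, elim conjE)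
    fix U u assume U: "\<forall>m. U m \<in> A" and u: "u \<in> extensional (cball 0 1)"
      and lim: "uniform_limit (cball 0 1) U u sequentially"
    obtain f where f: "\<And>m. f m \<in> B" "\<And>m. U m = R (f m)" using U unfolding A_def image_iff by metis
    have "uniformly_Cauchy_on (cball 0 1) U"
      using lim by (intro uniformly_convergent_Cauchy) (auto simp: uniformly_convergent_on_def)
    \<comment> \<open>The inequality \<open>isom\<close> carries the Cauchy property from the closed
      disk back to \<open>K\<close>, where completeness then yields a limit.\<close>
    have "uniformly_Cauchy_on K f"
    proof (rule uniformly_Cauchy_onI)
      fix e :: real assume "0 < e"
      then obtain M where M: "\<And>z m n. z \<in> cball 0 1 \<Longrightarrow> M \<le> m \<Longrightarrow> M \<le> n \<Longrightarrow> dist (U m z) (U n z) < e"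
        using \<open>uniformly_Cauchy_on (cball 0 1) U\<close> unfolding uniformly_Cauchy_on_def by meson
      have "dist (f m x) (f n x) < e" if mn: "x \<in> K" "M \<le> m" "M \<le> n" for x m n
      proof -
        obtain z where "z \<in> cball 0 1" "norm (f m x - f n x) \<le> norm (R (f m) z - R (f n) z)"
          using isom[OF f(1) f(1) mn(1)] by blast
        then show ?thesis using M[of z m n] mn by (simp add: f(2) dist_norm)
      qed
      then show "\<exists>M. \<forall>x\<in>K. \<forall>m\<ge>M. \<forall>n\<ge>M. dist (f m x) (f n x) < e" by blast
    qed
    then obtain l where l: "uniform_limit K f l sequentially"
      using Cauchy_uniformly_convergent by (auto simp: uniformly_convergent_on_def)
    \<comment> \<open>Restriction gives the limit the default value outside \<open>K\<close>, as
      \<open>uniformly_closed\<close> demands of it.\<close>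
    define g where "g = restrict l K"
    have fg: "uniform_limit K f g sequentially"
      using l by (rule uniform_limit_cong'[THEN iffD1, rotated 2]) (auto simp: g_def)
    then have gB: "g \<in> B"
      using closed f(1) unfolding uniformly_closed_def by (auto simp: g_def)
    have "u z = R g z" if z: "z \<in> cball 0 1" for z
    proof -
      have "(\<lambda>m. U m z) \<longlonglongrightarrow> R g z"
        using tendsto_uniform_limitI[OF fg \<phi>[OF z]] z by (simp add: f(2) R_def)
      moreover have "(\<lambda>m. U m z) \<longlonglongrightarrow> u z" using tendsto_uniform_limitI[OF lim z] .
      ultimately show ?thesis by (rule LIMSEQ_unique[symmetric])
    qed
    then have "u = R g" using u by (intro extensionalityI[of u "cball 0 1"]) (auto simp: R_def)
    then show "u \<in> A" using gB by (simp add: A_def)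
  qed
  \<comment> \<open>The isomorphism has to run from the subalgebra \<open>A\<close> to
    \<open>B\<close>, so it is the inverse of the pullback.\<close>
  moreover have "algebra_isomorphic (cball 0 1) A K B"
    unfolding algebra_isomorphic_def
  proof (intro exI[of _ "inv_into B R"] conjI ballI allI)
    have inv: "inv_into B R (R f) = f" if "f \<in> B" for f using inj that by (rule inv_into_f_f)
    show "bij_betw (inv_into B R) A B"
      using inj by (intro bij_betw_inv_into) (simp add: A_def bij_betw_def)
    show "inv_into B R (\<lambda>z\<in>cball 0 1. 1) = (\<lambda>x\<in>K. 1)"
      unfolding R_one[symmetric] by (intro inv B)
    fix u v c assume "u \<in> A" 
    then obtain f where f: "f \<in> B" "u = R f" by (auto simp: A_def)
    show "inv_into B R (\<lambda>z\<in>cball 0 1. c * u z) = (\<lambda>x\<in>K. c * inv_into B R u x)"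
      unfolding f R_scale[symmetric] inv[OF f(1)] by (intro inv B f)
    assume "v \<in> A"
    then obtain g where g: "g \<in> B" "v = R g" by (auto simp: A_def)
    show "inv_into B R (\<lambda>z\<in>cball 0 1. u z + v z) = (\<lambda>x\<in>K. inv_into B R u x + inv_into B R v x)"
      unfolding f g R_add[symmetric] inv[OF f(1)] inv[OF g(1)] by (intro inv B f g)
    show "inv_into B R (\<lambda>z\<in>cball 0 1. u z * v z) = (\<lambda>x\<in>K. inv_into B R u x * inv_into B R v x)"
      unfolding f g R_mult[symmetric] inv[OF f(1)] inv[OF g(1)] by (intro inv B f g)
  qed
  ultimately show ?thesis by blast
qed

section \<open>Holomorphic functions of several variables\<close>

lemma norm_vector_smult: "norm (c *s v) = norm c * norm (v :: complex ^ 'n::finite)"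
proof -
  have "norm (c *s v) = L2_set (\<lambda>i. norm c * norm (v $ i)) UNIV"
    by (simp add: norm_vec_def norm_mult)
  also have "\<dots> = norm c * norm v"
    unfolding norm_vec_def by (rule L2_set_right_distrib[symmetric]) simp
  finally show ?thesis .
qed

lemma bounded_linear_vector_smult: "bounded_linear (\<lambda>c. c *s (v :: complex ^ 'n::finite))"
  by (rule bounded_linear_intro[where K = "norm v"])
    (auto simp: vec_eq_iff algebra_simps norm_vector_smult)

lemma norm_le_closed_polydisk:
  fixes z :: "complex ^ 'n::finite"
  assumes "z \<in> closed_polydisk"
  shows "norm z \<le> CARD('n)"
proof -
  have "norm z \<le> (\<Sum>i\<in>UNIV. norm (z $ i))" unfolding norm_vec_def by (rule L2_set_le_sum) auto
  also have "\<dots> \<le> (\<Sum>i\<in>(UNIV :: 'n set). 1)"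
    using assms by (intro sum_mono) (auto simp: closed_polydisk_def)
  finally show ?thesis by simp
qed

lemma open_open_polydisk: "open (open_polydisk :: (complex ^ 'n::finite) set)"
  unfolding open_polydisk_def by (rule open_vector_box) auto

lemma compact_closed_polydisk: "compact (closed_polydisk :: (complex ^ 'n::finite) set)"
proof -
  have "closed (closed_polydisk :: (complex ^ 'n) set)"
    unfolding closed_polydisk_def by (rule closed_vector_box) auto
  moreover have "bounded (closed_polydisk :: (complex ^ 'n) set)"
    using norm_le_closed_polydisk by (auto simp: bounded_iff)
  ultimately show ?thesis by (simp add: compact_eq_bounded_closed)
qed

lemma open_polydisk_subset: "open_polydisk \<subseteq> closed_polydisk"
  by (auto simp: open_polydisk_def closed_polydisk_def intro: less_imp_le)

lemma holomorphic_several_on_imp_continuous_on: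
  "holomorphic_several_on f U \<Longrightarrow> continuous_on U f"
  unfolding holomorphic_several_on_def
  by (meson continuous_at_imp_continuous_on has_derivative_continuous)

lemma holomorphic_several_transform:
  assumes "holomorphic_several_on f U" "open U" "\<And>z. z \<in> U \<Longrightarrow> f z = g z"
  shows "holomorphic_several_on g U"
  unfolding holomorphic_several_on_def
proof
  fix z assume z: "z \<in> U"
  then obtain f' where f': "(f has_derivative f') (at z)" "\<And>c v. f' (c *s v) = c * f' v"
    using assms(1) unfolding holomorphic_several_on_def by blast
  have "(g has_derivative f') (at z)"
    using f'(1) assms(2) z assms(3) by (rule has_derivative_transform_within_open)
  then show "\<exists>g'. (g has_derivative g') (at z) \<and> (\<forall>c v. g' (c *s v) = c * g' v)"
    using f'(2) by blast
qed

text \<open>The chain rule gives the real derivative \<open>h \<mapsto> f' (h *s g')\<close>;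
  complex linearity of \<open>f'\<close> turns it into multiplication by
  \<open>f' g'\<close>.\<close>

lemma has_field_derivative_compose_several:
  fixes g :: "complex \<Rightarrow> complex ^ 'n::finite"
  assumes f: "(f has_derivative f') (at (g t))" and lin: "\<And>c v. f' (c *s v) = c * f' v"
    and g: "\<And>i. ((\<lambda>t. g t $ i) has_field_derivative g' $ i) (at t)"
  shows "((\<lambda>t. f (g t)) has_field_derivative f' g') (at t)"
proof -
  \<comment> \<open>The derivative of \<open>g\<close> is known only by coordinates, so
    \<open>g\<close> is expanded in the standard basis.\<close>
  have "((\<lambda>t. \<Sum>i\<in>UNIV. (g t $ i) *s axis i 1) has_derivative
      (\<lambda>h. \<Sum>i\<in>UNIV. (g' $ i * h) *s axis i 1)) (at t)"
    using g unfolding has_field_derivative_def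
    by (intro has_derivative_sum bounded_linear.has_derivative[OF bounded_linear_vector_smult])
  moreover have "(\<Sum>i\<in>UNIV. (g' $ i * h) *s axis i 1) = h *s g'" for h
  proof -
    have "(\<Sum>i\<in>UNIV. ((h *s g') $ i) *s axis i 1) = h *s g'" by (rule basis_expansion)
    then show ?thesis by (simp add: mult.commute)
  qed
  ultimately have "(g has_derivative (\<lambda>h. h *s g')) (at t)" by (simp add: basis_expansion)
  then have "((\<lambda>t. f (g t)) has_derivative (\<lambda>h. f' (h *s g'))) (at t)"
    using f by (rule has_derivative_compose)
  then show ?thesis by (simp add: has_field_derivative_def lin mult.commute[of _ "f' g'"] cong: if_cong)
qed

lemma holomorphic_on_compose_several:
  fixes g :: "complex \<Rightarrow> complex ^ 'n::finite"
  assumes f: "holomorphic_several_on f U" and S: "open S"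
    and g: "\<And>i. (\<lambda>t. g t $ i) holomorphic_on S" and into: "\<And>t. t \<in> S \<Longrightarrow> g t \<in> U"
  shows "(\<lambda>t. f (g t)) holomorphic_on S"
proof (rule holomorphic_onI)
  fix t assume t: "t \<in> S"
  obtain f' where f': "(f has_derivative f') (at (g t))" "\<And>c v. f' (c *s v) = c * f' v"
    using f into[OF t] unfolding holomorphic_several_on_def by blast
  have "((\<lambda>t. g t $ i) has_field_derivative (\<chi> i. deriv (\<lambda>t. g t $ i) t) $ i) (at t)" for i
    using holomorphic_derivI[OF g S t] by simp
  from has_field_derivative_compose_several[OF f' this]
  show "(\<lambda>t. f (g t)) field_differentiable at t within S"
    by (meson field_differentiable_at_within field_differentiable_def)
qed

text \<open>Cauchy's inequality on the complex line through \<open>z\<close> in direction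
  \<open>v\<close>, which stays in the ball for parameters up to \<open>r / norm v\<close>.\<close>

lemma holomorphic_several_derivative_bound:
  fixes f :: "complex ^ 'n::finite \<Rightarrow> complex"
  assumes f: "holomorphic_several_on f U" and sub: "cball z r \<subseteq> U" and r: "0 < r"
    and bound: "\<And>w. w \<in> cball z r \<Longrightarrow> norm (f w) \<le> M"
    and f': "(f has_derivative f') (at z)" and lin: "\<And>c v. f' (c *s v) = c * f' v"
  shows "norm (f' v) \<le> M / r * norm v"
proof (cases "v = 0")
  case True
  then show ?thesis using lin[of 0 v] by simp
next
  case False
  define \<rho> where "\<rho> = r / norm v"
  have \<rho>: "0 < \<rho>" using r False by (simp add: \<rho>_def)
  have in_cball: "z + t *s v \<in> cball z r" if "t \<in> cball 0 \<rho>" for t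
    using that False by (simp add: dist_norm norm_vector_smult \<rho>_def field_simps)
  have hol: "(\<lambda>t. f (z + t *s v)) holomorphic_on ball 0 \<rho>"
    by (rule holomorphic_on_compose_several[OF f])
      (use in_cball sub in \<open>auto intro!: holomorphic_intros\<close>)
  have cont: "continuous_on (cball 0 \<rho>) (\<lambda>t. f (z + t *s v))"
  proof (rule continuous_on_compose2[OF holomorphic_several_on_imp_continuous_on[OF f]])
    show "continuous_on (cball 0 \<rho>) (\<lambda>t. z + t *s v)"
      by (intro continuous_intros bounded_linear.continuous_on[OF bounded_linear_vector_smult])
    show "(\<lambda>t. z + t *s v) ` cball 0 \<rho> \<subseteq> U" using in_cball sub by blast
  qed
  have "norm ((deriv ^^ 1) (\<lambda>t. f (z + t *s v)) 0) \<le> fact 1 * M / \<rho> ^ 1"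
    using hol cont \<rho>
  proof (rule Cauchy_inequality)
    fix t :: complex assume "norm (0 - t) = \<rho>"
    then show "norm (f (z + t *s v)) \<le> M" using bound in_cball[of t] by auto
  qed
  moreover have "((\<lambda>t. f (z + t *s v)) has_field_derivative f' v) (at 0)"
    by (rule has_field_derivative_compose_several)
      (use f' lin in \<open>auto intro!: derivative_eq_intros\<close>)
  ultimately show ?thesis by (simp add: DERIV_imp_deriv \<rho>_def mult.commute)
qed

section \<open>Algebra operations and uniform limits of holomorphic functions\<close>

lemma holomorphic_several_add:
  assumes "holomorphic_several_on f U" "holomorphic_several_on g U"
  shows "holomorphic_several_on (\<lambda>z. f z + g z) U"
  unfolding holomorphic_several_on_def
proof
  fix z assume "z \<in> U"
  then obtain f' g' where "(f has_derivative f') (at z)" "\<And>c v. f' (c *s v) = c * f' v"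
    "(g has_derivative g') (at z)" "\<And>c v. g' (c *s v) = c * g' v"
    using assms unfolding holomorphic_several_on_def by metis
  then show "\<exists>h'. ((\<lambda>z. f z + g z) has_derivative h') (at z) \<and> (\<forall>c v. h' (c *s v) = c * h' v)"
    by (intro exI[of _ "\<lambda>v. f' v + g' v"] conjI has_derivative_add) (auto simp: algebra_simps)
qed

lemma holomorphic_several_mult:
  assumes "holomorphic_several_on f U" "holomorphic_several_on g U"
  shows "holomorphic_several_on (\<lambda>z. f z * g z) U"
  unfolding holomorphic_several_on_def
proof
  fix z assume "z \<in> U"
  then obtain f' g' where "(f has_derivative f') (at z)" "\<And>c v. f' (c *s v) = c * f' v"
    "(g has_derivative g') (at z)" "\<And>c v. g' (c *s v) = c * g' v"
    using assms unfolding holomorphic_several_on_def by metis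
  then show "\<exists>h'. ((\<lambda>z. f z * g z) has_derivative h') (at z) \<and> (\<forall>c v. h' (c *s v) = c * h' v)"
    by (intro exI[of _ "\<lambda>v. f z * g' v + f' v * g z"] conjI has_derivative_mult) (auto simp: algebra_simps)
qed

lemma holomorphic_several_const: "holomorphic_several_on (\<lambda>z. c) U"
  unfolding holomorphic_several_on_def by (auto intro!: exI[of _ "\<lambda>v. 0"])

text \<open>Cauchy estimates for the differences \<open>F m - F n\<close> make the derivatives
  uniformly Cauchy near \<open>z\<close>, relative to \<open>norm v\<close>. The theorem on
  differentiating sequences then gives a derivative of the limit, and complex linearity survives
  pointwise limits.\<close>

lemma holomorphic_several_uniform_limit:
  fixes F :: "nat \<Rightarrow> complex ^ 'n::finite \<Rightarrow> complex"
  assumes hol: "\<And>n. holomorphic_several_on (F n) U" and U: "open U"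
    and lim: "uniform_limit U F f sequentially"
  shows "holomorphic_several_on f U"
  unfolding holomorphic_several_on_def
proof
  fix z assume z: "z \<in> U"
  obtain D where D: "\<And>n x. x \<in> U \<Longrightarrow> (F n has_derivative D n x) (at x)"
    "\<And>n x c v. x \<in> U \<Longrightarrow> D n x (c *s v) = c * D n x v"
    using hol unfolding holomorphic_several_on_def by metis
  \<comment> \<open>The radius \<open>2 * r\<close> leaves room for closed balls of radius
    \<open>r\<close> around all points of \<open>ball z r\<close>, where the Cauchy estimates are
    taken.\<close>
  obtain r where r: "0 < r" "cball z (2 * r) \<subseteq> U"
  proof -
    obtain r where "0 < r" "cball z r \<subseteq> U" using U z open_contains_cball by blast
    then show ?thesis by (intro that[of "r / 2"]) auto
  qed
  have sub: "cball x r \<subseteq> U" if "x \<in> ball z r" for x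
  proof
    fix y assume "y \<in> cball x r"
    then have "dist z y \<le> 2 * r" using \<open>x \<in> ball z r\<close> dist_triangle[of z y x] by simp
    then show "y \<in> U" using r by auto
  qed
  have inU: "x \<in> U" if "x \<in> ball z r" for x using sub[OF that] r(1) by auto
  have cauchy: "\<exists>N. \<forall>m\<ge>N. \<forall>n\<ge>N. \<forall>x\<in>ball z r. \<forall>v. norm (D m x v - D n x v) \<le> e * norm v" if "0 < e" for e
  proof -
    have "uniformly_Cauchy_on U F"
      using lim by (intro uniformly_convergent_Cauchy) (auto simp: uniformly_convergent_on_def)
    then obtain N where N: "\<And>x m n. x \<in> U \<Longrightarrow> N \<le> m \<Longrightarrow> N \<le> n \<Longrightarrow> dist (F m x) (F n x) < e * r"
      using \<open>0 < e\<close> r(1) unfolding uniformly_Cauchy_on_def by (meson mult_pos_pos)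
    have "norm (D m x v - D n x v) \<le> e * norm v" if mn: "N \<le> m" "N \<le> n" and x: "x \<in> ball z r" for m n x v
    proof -
      define d where "d w = F m w + (-1) * F n w" for w
      have "holomorphic_several_on d U"
        unfolding d_def by (intro holomorphic_several_add holomorphic_several_mult holomorphic_several_const hol)
      moreover have "norm (d w) \<le> e * r" if "w \<in> cball x r" for w
        using N[OF subsetD[OF sub[OF x] that] mn] by (simp add: d_def dist_norm)
      moreover have "(d has_derivative (\<lambda>v. D m x v - D n x v)) (at x)"
        unfolding d_def using has_derivative_diff[OF D(1) D(1), OF inU[OF x] inU[OF x], of m n] by simp
      moreover have "D m x (c *s v) - D n x (c *s v) = c * (D m x v - D n x v)" for c v
        using D(2)[OF inU[OF x]] by (simp add: algebra_simps)
      ultimately have "norm (D m x v - D n x v) \<le> (e * r) / r * norm v"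
        by (rule holomorphic_several_derivative_bound[OF _ sub[OF x] r(1)])
      then show ?thesis using r(1) by simp
    qed
    then show ?thesis by blast
  qed
  define g' where "g' x v = lim (\<lambda>n. D n x v)" for x v
  have D_lim: "(\<lambda>n. D n x v) \<longlonglongrightarrow> g' x v" if x: "x \<in> ball z r" for x v
  proof -
    have "Cauchy (\<lambda>n. D n x v)"
    proof (rule metric_CauchyI)
      fix e :: real assume "0 < e"
      \<comment> \<open>The summand 1 covers \<open>v = 0\<close>, and the factor 2 keeps
        \<open>e'\<close> positive with \<open>e' * norm v\<close> strictly below
        \<open>e\<close>.\<close>
      define e' where "e' = e / (2 * (norm v + 1))"
      have "0 < norm v + 1" by (rule add_nonneg_pos) auto
      then have e': "0 < e'" "e' * norm v < e"
        using \<open>0 < e\<close> by (auto simp: e'_def divide_simps)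
      obtain N where "\<forall>m\<ge>N. \<forall>n\<ge>N. \<forall>x\<in>ball z r. \<forall>v. norm (D m x v - D n x v) \<le> e' * norm v"
        using cauchy[OF e'(1)] by blast
      then show "\<exists>N. \<forall>m\<ge>N. \<forall>n\<ge>N. dist (D m x v) (D n x v) < e"
        using x e'(2) unfolding dist_norm by (meson le_less_trans)
    qed
    then show ?thesis by (simp add: g'_def Cauchy_convergent convergent_LIMSEQ_iff[symmetric])
  qed
  have "\<forall>\<^sub>F n in sequentially. \<forall>x\<in>ball z r. \<forall>v. norm (D n x v - g' x v) \<le> e * norm v" if "0 < e" for e
  proof -
    obtain N where N: "\<forall>m\<ge>N. \<forall>n\<ge>N. \<forall>x\<in>ball z r. \<forall>v. norm (D m x v - D n x v) \<le> e * norm v"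
      using cauchy[OF \<open>0 < e\<close>] by blast
    have "norm (D n x v - g' x v) \<le> e * norm v" if "N \<le> n" "x \<in> ball z r" for n x v
    proof (rule LIMSEQ_le_const2)
      show "(\<lambda>m. norm (D n x v - D m x v)) \<longlonglongrightarrow> norm (D n x v - g' x v)"
        by (intro tendsto_intros D_lim that)
      show "\<exists>M. \<forall>m\<ge>M. norm (D n x v - D m x v) \<le> e * norm v" using N that by blast
    qed
    then show ?thesis unfolding eventually_sequentially by blast
  qed
  moreover have "(F n has_derivative D n x) (at x within ball z r)" if "x \<in> ball z r" for n x
    using D(1)[OF inU[OF that]] by (rule has_derivative_at_withinI)
  moreover have "z \<in> ball z r" using r(1) by simp
  moreover have "(\<lambda>n. F n z) \<longlonglongrightarrow> f z" using tendsto_uniform_limitI[OF lim z] .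
  ultimately obtain g where g: "\<And>x. x \<in> ball z r \<Longrightarrow> (\<lambda>n. F n x) \<longlonglongrightarrow> g x"
    "\<And>x. x \<in> ball z r \<Longrightarrow> (g has_derivative g' x) (at x within ball z r)"
    using has_derivative_sequence[OF convex_ball, of z r F D g' z "f z"] by blast
  \<comment> \<open>The sequence theorem produces some limit function \<open>g\<close>; uniqueness
    of limits identifies it with \<open>f\<close>.\<close>
  have fg: "f x = g x" if "x \<in> ball z r" for x
    using tendsto_uniform_limitI[OF lim inU[OF that]] g(1)[OF that] by (rule LIMSEQ_unique)
  have "(g has_derivative g' z) (at z)" using g(2)[of z] r(1) by (simp add: at_within_open[of z "ball z r"])
  then have "(f has_derivative g' z) (at z)"
    by (rule has_derivative_transform_within_open[of _ _ _ _ "ball z r"]) (use r(1) fg in auto)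
  moreover have "g' z (c *s v) = c * g' z v" for c v
  proof (rule LIMSEQ_unique)
    show "(\<lambda>n. D n z (c *s v)) \<longlonglongrightarrow> g' z (c *s v)" using r(1) by (intro D_lim) simp
    show "(\<lambda>n. D n z (c *s v)) \<longlonglongrightarrow> c * g' z v"
      unfolding D(2)[OF z] using r(1) by (intro tendsto_intros D_lim) simp
  qed
  ultimately show "\<exists>f'. (f has_derivative f') (at z) \<and> (\<forall>c v. f' (c *s v) = c * f' v)" by blast
qed

section \<open>Closedness of the continuous functions and of the polydisk algebra\<close>

lemma unital_subalgebra_continuous_functions:
  "unital_subalgebra K (continuous_functions K) (continuous_functions K)"
  unfolding unital_subalgebra_def continuous_functions_def
  by (auto intro!: continuous_intros simp: restrict_def extensional_def cong: continuous_on_cong_simp)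

lemma unital_subalgebra_polydisk_algebra:
  "unital_subalgebra closed_polydisk (continuous_functions closed_polydisk)
    (polydisk_algebra :: (complex ^ 'n::finite \<Rightarrow> complex) set)"
proof -
  \<comment> \<open>The default value outside the closed polydisk does not affect derivatives at
    points of the open one.\<close>
  have transform: "holomorphic_several_on (\<lambda>z\<in>closed_polydisk. f z) open_polydisk"
    if "holomorphic_several_on f open_polydisk" for f :: "complex ^ 'n \<Rightarrow> complex"
    using that open_open_polydisk
    by (rule holomorphic_several_transform) (use open_polydisk_subset in auto)
  show ?thesis
    using unital_subalgebra_continuous_functions[of "closed_polydisk :: (complex ^ 'n) set"]
    unfolding unital_subalgebra_def polydisk_algebra_def
    by (auto intro!: transform holomorphic_several_add holomorphic_several_mult holomorphic_several_const)
qed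

lemma uniformly_closed_continuous_functions: "uniformly_closed K (continuous_functions K)"
  unfolding uniformly_closed_def continuous_functions_def
  by (auto intro: uniform_limit_theorem[OF always_eventually])

lemma uniformly_closed_polydisk_algebra:
  "uniformly_closed closed_polydisk (polydisk_algebra :: (complex ^ 'n::finite \<Rightarrow> complex) set)"
  unfolding uniformly_closed_def
proof (intro allI impI, elim conjE)
  fix F and f :: "complex ^ 'n \<Rightarrow> complex"
  assume F: "\<forall>m. F m \<in> polydisk_algebra" and f: "f \<in> extensional closed_polydisk"
    and lim: "uniform_limit closed_polydisk F f sequentially"
  have "f \<in> continuous_functions closed_polydisk"
    using uniformly_closed_continuous_functions F f lim
    unfolding uniformly_closed_def polydisk_algebra_def by blast
  moreover have "holomorphic_several_on f open_polydisk"
    by (rule holomorphic_several_uniform_limit[OF _ open_open_polydisk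
          uniform_limit_on_subset[OF lim open_polydisk_subset]])
      (use F in \<open>auto simp: polydisk_algebra_def\<close>)
  ultimately show "f \<in> polydisk_algebra" by (simp add: polydisk_algebra_def)
qed

section \<open>The algebras\<close>

lemma disk_algebra_restrictI:
  assumes "continuous_on (cball 0 1) f" "f holomorphic_on ball 0 1"
  shows "(\<lambda>z\<in>cball 0 1. f z) \<in> disk_algebra"
proof -
  have "(\<lambda>z\<in>cball 0 1. f z) holomorphic_on ball 0 1"
    using assms(2) by (rule holomorphic_transform) auto
  moreover have "continuous_on (cball 0 1) (\<lambda>z\<in>cball 0 1. f z)"
    using assms(1) by (rule continuous_on_eq) auto
  ultimately show ?thesis by (auto simp: disk_algebra_def continuous_functions_def)
qed

lemma unital_subalgebra_disk_algebra: "unital_subalgebra (cball 0 1) disk_algebra disk_algebra"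
proof -
  have "continuous_on (cball 0 1) f" "f holomorphic_on ball 0 1" if "f \<in> disk_algebra" for f
    using that by (auto simp: disk_algebra_def continuous_functions_def)
  then show ?thesis
    by (intro unital_subalgebraI disk_algebra_restrictI continuous_intros holomorphic_intros) auto
qed

lemma uniformly_closed_disk_algebra: "uniformly_closed (cball 0 1) disk_algebra"
  unfolding uniformly_closed_def
proof (intro allI impI, elim conjE)
  fix F f assume F: "\<forall>m. F m \<in> disk_algebra" and f: "f \<in> extensional (cball 0 1)"
    and lim: "uniform_limit (cball 0 1) F f sequentially"
  have "continuous_on (cball 0 1) f \<and> f holomorphic_on ball 0 1"
    by (rule holomorphic_uniform_limit[OF always_eventually lim])
      (use F in \<open>auto simp: disk_algebra_def continuous_functions_def\<close>)
  then show "f \<in> disk_algebra" using f by (simp add: disk_algebra_def continuous_functions_def)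
qed

text \<open>
  A coordinate slice through a boundary point need not meet the open polydisk, so it is only
  a uniform limit of the slices of the dilated functions.
\<close>

lemma polydisk_algebra_slice_holomorphic:
  fixes f :: "complex ^ 'n::finite \<Rightarrow> complex" and v :: "complex \<Rightarrow> complex ^ 'n"
  assumes f: "f \<in> polydisk_algebra" and v: "\<And>t i. t \<in> cball 0 1 \<Longrightarrow> v t $ i \<in> cball 0 1"
    and hol: "\<And>i. (\<lambda>t. v t $ i) holomorphic_on ball 0 1" and cont: "continuous_on (cball 0 1) v"
  shows "(\<lambda>t. f (v t)) holomorphic_on ball 0 1"
proof -
  \<comment> \<open>Dilation factors below 1 and tending to 1: they push the closed polydisk into
    the open one, where \<open>f\<close> is holomorphic.\<close>
  define \<rho> :: "nat \<Rightarrow> real" where "\<rho> n = 1 - 1 / real (Suc n)" for n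
  have \<rho>: "0 \<le> \<rho> n" "\<rho> n < 1" for n by (auto simp: \<rho>_def)
  have f_cont: "continuous_on closed_polydisk f" and f_hol: "holomorphic_several_on f open_polydisk"
    using f by (auto simp: polydisk_algebra_def continuous_functions_def)
  have v_in: "v t \<in> closed_polydisk" if "t \<in> cball 0 1" for t
    using v[OF that] by (simp add: closed_polydisk_def)
  have dil_in: "of_real (\<rho> n) *s v t \<in> open_polydisk" if t: "t \<in> cball 0 1" for n t
  proof -
    have "\<rho> n * norm (v t $ i) < 1" for i
    proof -
      have "\<rho> n * norm (v t $ i) \<le> \<rho> n * 1" using \<rho> v[OF t] by (intro mult_left_mono) auto
      then show ?thesis using \<rho>(2)[of n] by simp
    qed
    then show ?thesis using \<rho> by (simp add: open_polydisk_def norm_mult)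
  qed
  have dil_hol: "(\<lambda>t. f (of_real (\<rho> n) *s v t)) holomorphic_on ball 0 1" for n
    by (rule holomorphic_on_compose_several[OF f_hol]) (use dil_in hol in \<open>auto intro!: holomorphic_intros\<close>)
  have dil_cont: "continuous_on (cball 0 1) (\<lambda>t. f (of_real (\<rho> n) *s v t))" for n
  proof (rule continuous_on_compose2[OF f_cont])
    have "continuous_on (cball 0 1) (\<lambda>t. \<chi> i. of_real (\<rho> n) * v t $ i)"
      by (intro continuous_intros cont)
    then show "continuous_on (cball 0 1) (\<lambda>t. of_real (\<rho> n) *s v t)"
      by (simp add: vector_scalar_mult_def)
    show "(\<lambda>t. of_real (\<rho> n) *s v t) ` cball 0 1 \<subseteq> closed_polydisk"
      using dil_in open_polydisk_subset by blast
  qed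
  have ul: "uniform_limit (cball 0 1) (\<lambda>n t. f (of_real (\<rho> n) *s v t)) (\<lambda>t. f (v t)) sequentially"
  proof (rule uniform_limitI)
    fix e :: real assume "0 < e"
    then obtain d where d: "0 < d" "\<And>x y. x \<in> closed_polydisk \<Longrightarrow> y \<in> closed_polydisk \<Longrightarrow>
        dist y x < d \<Longrightarrow> dist (f y) (f x) < e"
      using compact_uniformly_continuous[OF f_cont compact_closed_polydisk]
      unfolding uniformly_continuous_on_def by meson
    \<comment> \<open>Dilation moves a point by \<open>1 / Suc n\<close> times its norm, and points
      of the closed polydisk have norm at most the dimension. Uniform continuity of \<open>f\<close>
      does the rest.\<close>
    have "(\<lambda>n. 1 / real (Suc n) * CARD('n)) \<longlonglongrightarrow> 0 * real CARD('n)"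
      by (intro tendsto_intros LIMSEQ_inverse_real_of_nat[unfolded inverse_eq_divide])
    then have "(\<lambda>n. 1 / real (Suc n) * CARD('n)) \<longlonglongrightarrow> 0" by simp
    then have "\<forall>\<^sub>F n in sequentially. 1 / real (Suc n) * CARD('n) < d"
      by (rule order_tendstoD) (rule d(1))
    then show "\<forall>\<^sub>F n in sequentially. \<forall>t\<in>cball 0 1. dist (f (of_real (\<rho> n) *s v t)) (f (v t)) < e"
    proof eventually_elim
      case (elim n)
      show ?case
      proof
        fix t :: complex assume t: "t \<in> cball 0 1"
        have "of_real (\<rho> n) *s v t - v t = of_real (- (1 / real (Suc n))) *s v t"
          by (simp add: vec_eq_iff \<rho>_def algebra_simps)
        then have "dist (of_real (\<rho> n) *s v t) (v t) = norm (of_real (- (1 / real (Suc n))) *s v t)"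
          by (simp only: dist_norm)
        also have "\<dots> = 1 / real (Suc n) * norm (v t)"
          unfolding norm_vector_smult norm_of_real by simp
        also have "\<dots> \<le> 1 / real (Suc n) * CARD('n)"
          by (intro mult_left_mono norm_le_closed_polydisk v_in t) simp
        also have "\<dots> < d" by (rule elim)
        finally show "dist (f (of_real (\<rho> n) *s v t)) (f (v t)) < e"
          by (intro d(2) v_in t subsetD[OF open_polydisk_subset dil_in])
      qed
    qed
  qed
  show ?thesis
    by (rule holomorphic_uniform_limit[OF always_eventually ul]) (use dil_hol dil_cont in auto)
qed

section \<open>Closure properties and induction for the infinite polydisk algebra\<close>

lemma unital_subalgebra_Inter:
  assumes "\<And>A. A \<in> \<A> \<Longrightarrow> unital_subalgebra K B A" "\<A> \<noteq> {}"
  shows "unital_subalgebra K B (\<Inter>\<A>)"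
  using assms unfolding unital_subalgebra_def by blast

lemma uniformly_closed_Inter:
  assumes "\<And>A. A \<in> \<A> \<Longrightarrow> uniformly_closed K A"
  shows "uniformly_closed K (\<Inter>\<A>)"
  using assms unfolding uniformly_closed_def by blast

lemma coordinate_continuous_function:
  "(\<lambda>z\<in>S. z k :: complex) \<in> continuous_functions S"
proof -
  have "continuous_on S (\<lambda>z\<in>S. z k :: complex)"
    by (rule continuous_on_eq[OF continuous_on_subset[OF continuous_on_product_coordinates]]) auto
  then show ?thesis by (auto simp: continuous_functions_def)
qed

lemma infinite_polydisk_algebra_properties:
  "unital_subalgebra infinite_polydisk (continuous_functions infinite_polydisk) infinite_polydisk_algebra"
  "uniformly_closed infinite_polydisk infinite_polydisk_algebra"
proof -
  show "unital_subalgebra infinite_polydisk (continuous_functions infinite_polydisk) infinite_polydisk_algebra"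
    unfolding infinite_polydisk_algebra_def
  proof (rule unital_subalgebra_Inter)
    \<comment> \<open>The full algebra of continuous functions is a member, so the intersection is
      over a nonempty family.\<close>
    have "continuous_functions infinite_polydisk \<in>
        {A. unital_subalgebra infinite_polydisk (continuous_functions infinite_polydisk) A \<and>
          uniformly_closed infinite_polydisk A \<and> (\<forall>k. (\<lambda>z\<in>infinite_polydisk. z k) \<in> A)}"
      using coordinate_continuous_function unital_subalgebra_continuous_functions
        uniformly_closed_continuous_functions by (intro CollectI conjI allI)
    then show "{A. unital_subalgebra infinite_polydisk (continuous_functions infinite_polydisk) A \<and>
          uniformly_closed infinite_polydisk A \<and> (\<forall>k. (\<lambda>z\<in>infinite_polydisk. z k) \<in> A)} \<noteq> {}"
      by fast
  qed simp
  show "uniformly_closed infinite_polydisk infinite_polydisk_algebra"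
    unfolding infinite_polydisk_algebra_def by (rule uniformly_closed_Inter) simp
qed

text \<open>Serves as an induction principle: a property holds on the whole algebra once the
  functions having it form a closed unital subalgebra containing the coordinates.\<close>

lemma infinite_polydisk_algebra_subset:
  assumes "unital_subalgebra infinite_polydisk (continuous_functions infinite_polydisk) A"
    "uniformly_closed infinite_polydisk A" "\<And>k. (\<lambda>z\<in>infinite_polydisk. z k) \<in> A"
  shows "infinite_polydisk_algebra \<subseteq> A"
  unfolding infinite_polydisk_algebra_def using assms by blast

text \<open>By induction over the algebra: slices of coordinate functions are constant or the
  identity even through boundary points, and slices of uniform limits converge uniformly on the
  closed disk.\<close>

lemma infinite_polydisk_algebra_slice_holomorphic:
  assumes f: "f \<in> infinite_polydisk_algebra" and z: "z \<in> infinite_polydisk"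
  shows "(\<lambda>t. f (z(k := t))) holomorphic_on ball 0 1"
proof -
  let ?K = "infinite_polydisk"
  define H where "H = {f \<in> continuous_functions ?K. (\<lambda>t. f (z(k := t))) holomorphic_on ball 0 1}"
  have upd: "z(k := t) \<in> ?K" if "t \<in> cball 0 1" for t
    using fun_upd_infinite_polydisk[OF z] that by simp
  have transform: "(\<lambda>t. (\<lambda>x\<in>?K. g x) (z(k := t))) holomorphic_on ball 0 1"
    if "(\<lambda>t. g (z(k := t))) holomorphic_on ball 0 1" for g :: "(nat \<Rightarrow> complex) \<Rightarrow> complex"
    using that by (rule holomorphic_transform) (use upd in auto)
  have "unital_subalgebra ?K (continuous_functions ?K) H"
  proof (rule unital_subalgebraI)
    note C = unital_subalgebraD[OF unital_subalgebra_continuous_functions[of ?K]]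
    show "H \<subseteq> continuous_functions ?K" by (auto simp: H_def)
    show "(\<lambda>x\<in>?K. 1) \<in> H"
      unfolding H_def by (intro CollectI conjI C transform) simp
    fix f g c assume "f \<in> H"
    then have f: "f \<in> continuous_functions ?K" "(\<lambda>t. f (z(k := t))) holomorphic_on ball 0 1"
      by (auto simp: H_def)
    show "(\<lambda>x\<in>?K. c * f x) \<in> H"
      unfolding H_def by (intro CollectI conjI C transform holomorphic_on_mult holomorphic_on_const f)
    assume "g \<in> H"
    then have g: "g \<in> continuous_functions ?K" "(\<lambda>t. g (z(k := t))) holomorphic_on ball 0 1"
      by (auto simp: H_def)
    show "(\<lambda>x\<in>?K. f x + g x) \<in> H"
      unfolding H_def by (intro CollectI conjI C transform holomorphic_on_add f g)
    show "(\<lambda>x\<in>?K. f x * g x) \<in> H"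
      unfolding H_def by (intro CollectI conjI C transform holomorphic_on_mult f g)
  qed
  moreover have "uniformly_closed ?K H"
    unfolding uniformly_closed_def
  proof (intro allI impI, elim conjE)
    fix F f assume F: "\<forall>m. F m \<in> H" and f: "f \<in> extensional ?K"
      and lim: "uniform_limit ?K F f sequentially"
    have "f \<in> continuous_functions ?K"
      by (rule uniformly_closedD[OF uniformly_closed_continuous_functions _ f lim]) (use F in \<open>auto simp: H_def\<close>)
    moreover have "uniform_limit (cball 0 1) (\<lambda>m t. F m (z(k := t))) (\<lambda>t. f (z(k := t))) sequentially"
      using lim upd by (intro uniform_limit_compose'[OF lim]) auto
    then have "(\<lambda>t. f (z(k := t))) holomorphic_on ball 0 1"
    proof (rule holomorphic_uniform_limit[OF always_eventually, rotated])
      show "\<forall>m. continuous_on (cball 0 1) (\<lambda>t. F m (z(k := t))) \<and> (\<lambda>t. F m (z(k := t))) holomorphic_on ball 0 1"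
      proof (intro allI conjI)
        fix m
        have Fm: "continuous_on ?K (F m)" "(\<lambda>t. F m (z(k := t))) holomorphic_on ball 0 1"
          using F by (auto simp: H_def continuous_functions_def)
        show "(\<lambda>t. F m (z(k := t))) holomorphic_on ball 0 1" by (rule Fm)
        show "continuous_on (cball 0 1) (\<lambda>t. F m (z(k := t)))"
          by (rule continuous_on_compose2[OF Fm(1) continuous_on_fun_upd]) (use upd in auto)
      qed
    qed auto
    ultimately show "f \<in> H" by (simp add: H_def)
  qed
  moreover have "(\<lambda>x\<in>?K. x j) \<in> H" for j
  proof -
    have "(\<lambda>t. (z(k := t)) j) holomorphic_on ball 0 1"
      by (cases "j = k") auto
    then show ?thesis
      unfolding H_def by (intro CollectI conjI transform coordinate_continuous_function)
  qed
  ultimately have "infinite_polydisk_algebra \<subseteq> H" by (rule infinite_polydisk_algebra_subset)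
  then show ?thesis using f by (auto simp: H_def)
qed

text \<open>By induction over the algebra: coordinates pull back to the \<open>F j\<close>, pullback
  respects the operations, and the disk algebra is uniformly closed.\<close>

lemma infinite_polydisk_algebra_pullback:
  assumes f: "f \<in> infinite_polydisk_algebra"
    and F: "\<And>k. continuous_on (cball 0 1) (F k)" "\<And>k. F k holomorphic_on ball 0 1"
      "\<And>k z. z \<in> cball 0 1 \<Longrightarrow> norm (F k z) \<le> 1"
  shows "(\<lambda>z\<in>cball 0 1. f (\<lambda>k. F k z)) \<in> disk_algebra"
proof -
  let ?K = "infinite_polydisk"
  define R where "R f = (\<lambda>z\<in>cball 0 1. f (\<lambda>k. F k z))" for f :: "(nat \<Rightarrow> complex) \<Rightarrow> complex"
  define H where "H = {f \<in> continuous_functions ?K. R f \<in> disk_algebra}"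
  have F_in: "(\<lambda>k. F k z) \<in> ?K" if "z \<in> cball 0 1" for z
    using F(3)[OF that] by (simp add: infinite_polydisk_def)
  have R: "R (\<lambda>x\<in>?K. 1) = (\<lambda>z\<in>cball 0 1. 1)"
    "R (\<lambda>x\<in>?K. f x + g x) = (\<lambda>z\<in>cball 0 1. R f z + R g z)"
    "R (\<lambda>x\<in>?K. f x * g x) = (\<lambda>z\<in>cball 0 1. R f z * R g z)"
    "R (\<lambda>x\<in>?K. c * f x) = (\<lambda>z\<in>cball 0 1. c * R f z)" for f g c
    using F_in by (auto simp: R_def fun_eq_iff restrict_def)
  have "unital_subalgebra ?K (continuous_functions ?K) H"
  proof (rule unital_subalgebraI)
    note C = unital_subalgebraD[OF unital_subalgebra_continuous_functions[of ?K]]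
    note D = unital_subalgebraD[OF unital_subalgebra_disk_algebra]
    show "H \<subseteq> continuous_functions ?K" by (auto simp: H_def)
    show "(\<lambda>x\<in>?K. 1) \<in> H"
      unfolding H_def mem_Collect_eq R by (intro conjI C D)
    fix f g c assume "f \<in> H"
    then have f: "f \<in> continuous_functions ?K" "R f \<in> disk_algebra" by (auto simp: H_def)
    show "(\<lambda>x\<in>?K. c * f x) \<in> H"
      unfolding H_def mem_Collect_eq R(4) by (intro conjI C(5) D(5) f)
    assume "g \<in> H"
    then have g: "g \<in> continuous_functions ?K" "R g \<in> disk_algebra" by (auto simp: H_def)
    show "(\<lambda>x\<in>?K. f x + g x) \<in> H" "(\<lambda>x\<in>?K. f x * g x) \<in> H"
      unfolding H_def mem_Collect_eq R by (intro conjI C D f g)+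
  qed
  moreover have "uniformly_closed ?K H"
    unfolding uniformly_closed_def
  proof (intro allI impI, elim conjE)
    fix G g assume G: "\<forall>m. G m \<in> H" and g: "g \<in> extensional ?K"
      and lim: "uniform_limit ?K G g sequentially"
    have gC: "g \<in> continuous_functions ?K"
      by (rule uniformly_closedD[OF uniformly_closed_continuous_functions _ g lim]) (use G in \<open>auto simp: H_def\<close>)
    have "uniform_limit (cball 0 1) (\<lambda>m z. G m (\<lambda>k. F k z)) (\<lambda>z. g (\<lambda>k. F k z)) sequentially"
      by (rule uniform_limit_compose'[OF lim]) (use F_in in auto)
    then have lim': "uniform_limit (cball 0 1) (\<lambda>m. R (G m)) (R g) sequentially"
      by (rule uniform_limit_cong'[THEN iffD1, rotated 2]) (auto simp: R_def)
    have "R (G m) \<in> disk_algebra" for m using G by (simp add: H_def)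
    moreover have "R g \<in> extensional (cball 0 1)" by (simp add: R_def)
    ultimately have "R g \<in> disk_algebra"
      using lim' by (rule uniformly_closedD[OF uniformly_closed_disk_algebra])
    with gC show "g \<in> H" by (simp add: H_def)
  qed
  moreover have "(\<lambda>x\<in>?K. x j) \<in> H" for j
  proof -
    have "R (\<lambda>x\<in>?K. x j) = (\<lambda>z\<in>cball 0 1. F j z)"
      using F_in by (auto simp: R_def fun_eq_iff restrict_def)
    then have "R (\<lambda>x\<in>?K. x j) \<in> disk_algebra" using disk_algebra_restrictI[OF F(1,2)] by simp
    then show ?thesis using coordinate_continuous_function by (simp add: H_def)
  qed
  ultimately have "infinite_polydisk_algebra \<subseteq> H" by (rule infinite_polydisk_algebra_subset)
  then show ?thesis using f by (auto simp: H_def R_def)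
qed

section \<open>Both embeddings from a single curve\<close>

theorem theorem2p1:
  shows "(\<exists>A. unital_subalgebra (cball 0 1) disk_algebra A \<and> uniformly_closed (cball 0 1) A \<and>
            algebra_isomorphic (cball 0 1) A
              closed_polydisk (polydisk_algebra :: (complex ^ 'n::finite \<Rightarrow> complex) set)) \<and>
         (\<exists>A. unital_subalgebra (cball 0 1) disk_algebra A \<and> uniformly_closed (cball 0 1) A \<and>
            algebra_isomorphic (cball 0 1) A infinite_polydisk infinite_polydisk_algebra)"
proof -
  obtain F :: "nat \<Rightarrow> complex \<Rightarrow> complex" where
    F: "\<And>k. continuous_on (cball 0 1) (F k)" "\<And>k. F k holomorphic_on ball 0 1"
      "\<And>k z. z \<in> cball 0 1 \<Longrightarrow> norm (F k z) \<le> 1" "\<And>k z. z \<in> ball 0 1 \<Longrightarrow> norm (F k z) < 1"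
    and onto: "\<And>w. \<forall>k. norm (w k) = 1 \<Longrightarrow> \<exists>z\<in>cball 0 1. \<forall>k. F k z = w k"
    by (rule disk_curve_through_torus) (rule that)
  \<comment> \<open>The maximum principle moves the point to the torus, and the curve passes through
    every point of the torus.\<close>
  have attained: "\<exists>\<zeta>\<in>cball 0 1. norm (f z) \<le> norm (f (\<lambda>k. F k \<zeta>))"
    if f: "continuous_on infinite_polydisk f"
      "\<And>k z. z \<in> infinite_polydisk \<Longrightarrow> (\<lambda>t. f (z(k := t))) holomorphic_on ball 0 1"
      and z: "z \<in> infinite_polydisk" for f z
  proof -
    obtain w where w: "\<And>k. norm (w k) = 1" "norm (f z) \<le> norm (f w)"
      using infinite_polydisk_maximum_on_torus[OF f z] by blast
    obtain \<zeta> where "\<zeta> \<in> cball 0 1" "\<forall>k. F k \<zeta> = w k" using onto[of w] w(1) by blast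
    then show ?thesis using w(2) by (intro bexI[of _ \<zeta>]) auto
  qed
  \<comment> \<open>Numbering the finitely many coordinates injectively selects that many of the
    \<open>F k\<close>, so the same curve serves every dimension.\<close>
  obtain e :: "'n \<Rightarrow> nat" where e: "inj e"
    using finite_imp_inj_to_nat_seg[of "UNIV :: 'n set"] by auto
  have "\<exists>A. unital_subalgebra (cball 0 1) disk_algebra A \<and> uniformly_closed (cball 0 1) A \<and>
      algebra_isomorphic (cball 0 1) A
        closed_polydisk (polydisk_algebra :: (complex ^ 'n \<Rightarrow> complex) set)"
  proof (rule closed_subalgebra_by_pullback[where \<phi> = "\<lambda>z. \<chi> i. F (e i) z"])
    show "unital_subalgebra closed_polydisk (continuous_functions closed_polydisk)
        (polydisk_algebra :: (complex ^ 'n \<Rightarrow> complex) set)"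
      by (rule unital_subalgebra_polydisk_algebra)
    show "uniformly_closed closed_polydisk (polydisk_algebra :: (complex ^ 'n \<Rightarrow> complex) set)"
      by (rule uniformly_closed_polydisk_algebra)
    show "(polydisk_algebra :: (complex ^ 'n \<Rightarrow> complex) set) \<subseteq> extensional closed_polydisk"
      by (auto simp: polydisk_algebra_def continuous_functions_def)
    show in_K: "(\<chi> i. F (e i) z) \<in> closed_polydisk" if "z \<in> cball 0 1" for z
      using F(3)[OF that] by (simp add: closed_polydisk_def)
    fix f :: "complex ^ 'n \<Rightarrow> complex" assume f: "f \<in> polydisk_algebra"
    then have f_cont: "continuous_on closed_polydisk f" and f_hol: "holomorphic_several_on f open_polydisk"
      by (auto simp: polydisk_algebra_def continuous_functions_def)
    show "(\<lambda>z\<in>cball 0 1. f (\<chi> i. F (e i) z)) \<in> disk_algebra"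
    proof (rule disk_algebra_restrictI)
      show "continuous_on (cball 0 1) (\<lambda>z. f (\<chi> i. F (e i) z))"
        by (rule continuous_on_compose2[OF f_cont]) (use in_K in \<open>auto intro!: continuous_intros F\<close>)
      \<comment> \<open>The strict bound on the \<open>F k\<close> is used here: holomorphy of
        \<open>f\<close> is given only on the open polydisk.\<close>
      show "(\<lambda>z. f (\<chi> i. F (e i) z)) holomorphic_on ball 0 1"
        by (rule holomorphic_on_compose_several[OF f_hol]) (use F in \<open>auto simp: open_polydisk_def\<close>)
    qed
    fix x :: "complex ^ 'n" assume x: "x \<in> closed_polydisk"
    \<comment> \<open>\<open>x\<close> is extended by 0 to a point of the infinite polydisk, and
      \<open>f\<close> is regarded as a function of the coordinates in \<open>range e\<close>; thus
      the maximum principle in infinitely many variables also covers the finite case.\<close>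
    define z where "z k = (if k \<in> range e then x $ inv e k else 0)" for k
    have z: "z \<in> infinite_polydisk"
      using x by (auto simp: infinite_polydisk_def closed_polydisk_def z_def)
    have ze: "(\<chi> i. z (e i)) = x" using e by (simp add: vec_eq_iff z_def)
    have "\<exists>\<zeta>\<in>cball 0 1. norm (f (\<chi> i. z (e i))) \<le> norm (f (\<chi> i. F (e i) \<zeta>))"
    proof (rule attained[OF _ _ z])
      have "continuous_on infinite_polydisk (\<lambda>z. (\<chi> i. z (e i)) :: complex ^ 'n)"
        by (intro continuous_on_vec_lambda continuous_on_subset[OF continuous_on_product_coordinates]) simp
      then show "continuous_on infinite_polydisk (\<lambda>z. f (\<chi> i. z (e i)))"
        by (rule continuous_on_compose2[OF f_cont]) (auto simp: infinite_polydisk_def closed_polydisk_def)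
      fix k and y :: "nat \<Rightarrow> complex" assume y: "y \<in> infinite_polydisk"
      show "(\<lambda>t. f (\<chi> i. (y(k := t)) (e i))) holomorphic_on ball 0 1"
      proof (rule polydisk_algebra_slice_holomorphic[OF f])
        show "(\<chi> i. (y(k := t)) (e i)) $ i \<in> cball 0 1" if "t \<in> cball 0 1" for t i
          using that y by (simp add: infinite_polydisk_def)
        show "(\<lambda>t. (\<chi> i. (y(k := t)) (e i)) $ i) holomorphic_on ball 0 1" for i
          by (cases "e i = k") auto
        show "continuous_on (cball 0 1) (\<lambda>t. \<chi> i. (y(k := t)) (e i))"
          by (rule continuous_on_vec_lambda, rule continuous_on_product_then_coordinatewise)
            (rule continuous_on_fun_upd)
      qed
    qed
    then show "\<exists>\<zeta>\<in>cball 0 1. norm (f x) \<le> norm (f (\<chi> i. F (e i) \<zeta>))" unfolding ze .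
  qed
  moreover have "\<exists>A. unital_subalgebra (cball 0 1) disk_algebra A \<and> uniformly_closed (cball 0 1) A \<and>
      algebra_isomorphic (cball 0 1) A infinite_polydisk infinite_polydisk_algebra"
  proof (rule closed_subalgebra_by_pullback[where \<phi> = "\<lambda>z k. F k z"])
    show "unital_subalgebra infinite_polydisk (continuous_functions infinite_polydisk) infinite_polydisk_algebra"
      "uniformly_closed infinite_polydisk infinite_polydisk_algebra"
      by (rule infinite_polydisk_algebra_properties)+
    then have sub: "infinite_polydisk_algebra \<subseteq> continuous_functions infinite_polydisk"
      by (simp add: unital_subalgebra_def)
    then show "infinite_polydisk_algebra \<subseteq> extensional infinite_polydisk"
      by (auto simp: continuous_functions_def)
    show "(\<lambda>k. F k z) \<in> infinite_polydisk" if "z \<in> cball 0 1" for z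
      using F(3)[OF that] by (simp add: infinite_polydisk_def)
    fix f assume f: "f \<in> infinite_polydisk_algebra"
    show "(\<lambda>z\<in>cball 0 1. f (\<lambda>k. F k z)) \<in> disk_algebra"
      using f F(1-3) by (rule infinite_polydisk_algebra_pullback)
    show "\<exists>\<zeta>\<in>cball 0 1. norm (f z) \<le> norm (f (\<lambda>k. F k \<zeta>))" if "z \<in> infinite_polydisk" for z
      by (rule attained[OF _ infinite_polydisk_algebra_slice_holomorphic[OF f] that])
        (use f sub in \<open>auto simp: continuous_functions_def\<close>)
  qed
  ultimately show ?thesis by blast
qed

end
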